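(* Let $t>0$ and let $\Gamma$ be a smooth curve as in the context. The mean curvature of the hypersurface $(M^3_\Gamma,h_t)$ in $(H^2,g_t)$ is $$\mathfrak H=\sqrt{\frac{2}{\sqrt{\rho^4(r^2+1)^2+t^4}}}\cdot k_g,$$ where $k_g=\frac12\big((\dot u\ddot v-\dot v\ddot u)(r^2+1)-2(u\dot v-v\dot u)\big)$ denotes the geodesic curvature of $\Gamma$ regarded as a curve in $S^2$. In particular, $M^3_\Gamma$ is a minimal surface (i.e. $\mathfrak H\equiv0$) if and only if $k_g=0$, i.e., if $\Gamma$ is a great circle (or an arc of one) in $S^2$.
   Context: Eguchi--Hanson space: $T^*\mathbb P^1(\mathbb C)$ is realized as $H^2=\{(\alpha,\beta,\gamma)\in(\mathbb C^2\setminus\{0\})\times\mathbb C\}/\sim$, where $(\alpha,\beta,\gamma)\sim(A\alpha,A\beta,\gamma/A^2)$ for $A\in\mathbb C^*$; the projection is $p([\alpha,\beta,\gamma])=\alpha/\beta\in\mathbb C\cup\{\infty\}=\mathbb P^1(\mathbb C)$. $M^4\subset H^2$ is the complement of the zero section $\{\gamma=0\}$, identified with $(\mathbb C^2\setminus\{0\})/\{\pm1\}$ by $[\alpha,\beta,\gamma]\mapsto \pm(z_1,z_2)=\pm(\alpha\sqrt\gamma,\beta\sqrt\gamma)$. Put $u_1=|z_1|^2+|z_2|^2$ and $f_t=\sqrt{u_1^2+t^4}+t^2\log\frac{u_1}{\sqrt{u_1^2+t^4}+t^2}$. The form $\omega_t=i\partial\bar\partial f_t$ extends to a Kähler form on $H^2$,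 and $g_t(X,Y)=\omega_t(X,JY)$ is the Eguchi--Hanson metric ($J$ the complex structure). Hypersurfaces: $\Gamma(s)=u(s)+iv(s)=r(s)e^{i\phi_\Gamma(s)}$ is a smooth curve in $\mathbb C$ parametrized by Euclidean arc length ($\dot u^2+\dot v^2=1$), $M^3_\Gamma=p^{-1}(\Gamma)\subset H^2$, and $h_t$ is the metric induced by $g_t$. $M^3_\Gamma\cap M^4$ is parametrized by $(s,\rho,\phi)$, $\rho>0$, via $\Psi(s,\rho,\phi)=\pm\rho e^{i\phi}(\Gamma(s),1)$ in the coordinates $\pm(z_1,z_2)$. The mean curvature $\mathfrak H$ is the trace (sum of the three eigenvalues with respect to $h_t$, not averaged) of the second fundamental form $\mathrm{II}(X,Y)=g_t(X,\nabla^{H^2}_YN)$, where $N$ is the unit normal field which in the real coordinates $z_1=x_1+ix_2$, $z_2=x_3+ix_4$ is $N=\frac12\sqrt{\frac{K}{r^2+1}}(w_1,-w_2,-rw_3,rw_4)$ with $K=\frac{2\rho^2(r^2+1)}{\sqrt{\rho^4(r^2+1)^2+t^4}}$, $w_1=\dot v\cos\phi+\dot u\sin\phi$, $w_2=\dot u\cos\phi-\dot v\sin\phi$, $w_3=\dot r\sin\phi+r\dot\phi_\Gamma\cos\phi$, $w_4=\dot r\cos\phi-r\dot\phi_\Gamma\sin\phi$. $S^2\simeq\mathbb C\cup\{\infty\}$ by stereographic projection; with the factor $\frac12$, $k_g$ is (up to sign, depending on orientation) the geodesic curvature for the round metric of curvature one, $\frac{4(du^2+dv^2)}{(1+u^2+v^2)^2}$.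 *)

theory Defs
  imports "HOL-Analysis.Analysis"
begin

section \<open>Riemannian metrics in one coordinate chart\<close>

text \<open>
  A metric on (an open subset of) a vector space is a function \<open>G p X Y\<close>. The Levi-Civita
  connection is \<open>D + B\<close>, where \<open>D\<close> is the flat derivative and the Christoffel tensor \<open>B p X Y\<close> is
  the unique solution of the conditions ``torsion-free'' and ``metric'', tested on constant
  vector fields.
\<close>

definition levi_civita ::
  "('a::real_normed_vector \<Rightarrow> 'a \<Rightarrow> 'a \<Rightarrow> real) \<Rightarrow> 'a \<Rightarrow> 'a \<Rightarrow> 'a \<Rightarrow> 'a" where
  "levi_civita G p = (THE B.
     (\<forall>X Y. B X Y = B Y X) \<and>
     (\<forall>X Y Z. frechet_derivative (\<lambda>q. G q Y Z) (at p) X = G p (B X Y) Z + G p Y (B X Z)))"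

text \<open>
  Covariant derivative, in the parameter direction \<open>e\<close>, of a vector field \<open>V\<close> along the map \<open>F\<close>.
\<close>

definition covariant_derivative ::
  "('a::real_normed_vector \<Rightarrow> 'a \<Rightarrow> 'a \<Rightarrow> real) \<Rightarrow> ('b::real_normed_vector \<Rightarrow> 'a) \<Rightarrow>
   ('b \<Rightarrow> 'a) \<Rightarrow> 'b \<Rightarrow> 'b \<Rightarrow> 'a" where
  "covariant_derivative G F V x e =
     frechet_derivative V (at x) e + levi_civita G (F x) (frechet_derivative F (at x) e) (V x)"

text \<open>
  First and second fundamental form of the parametrized hypersurface \<open>F\<close> with normal field \<open>N\<close>
  along \<open>F\<close>; the trace of the second with respect to the first is the sum of the eigenvalues.
\<close>

definition first_form ::
  "('a::real_normed_vector \<Rightarrow> 'a \<Rightarrow> 'a \<Rightarrow> real) \<Rightarrow> (real^'n \<Rightarrow> 'a) \<Rightarrow> real^'n \<Rightarrow> real^'n^'n" where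
  "first_form G F x = (\<chi> i j.
     G (F x) (frechet_derivative F (at x) (axis i 1)) (frechet_derivative F (at x) (axis j 1)))"

definition second_form ::
  "('a::real_normed_vector \<Rightarrow> 'a \<Rightarrow> 'a \<Rightarrow> real) \<Rightarrow> (real^'n \<Rightarrow> 'a) \<Rightarrow> (real^'n \<Rightarrow> 'a) \<Rightarrow>
   real^'n \<Rightarrow> real^'n^'n" where
  "second_form G F N x = (\<chi> i j.
     G (F x) (frechet_derivative F (at x) (axis i 1)) (covariant_derivative G F N x (axis j 1)))"

definition mean_curvature ::
  "('a::real_normed_vector \<Rightarrow> 'a \<Rightarrow> 'a \<Rightarrow> real) \<Rightarrow> (real^'n \<Rightarrow> 'a) \<Rightarrow> (real^'n \<Rightarrow> 'a) \<Rightarrow>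
   real^'n \<Rightarrow> real" where
  "mean_curvature G F N x = trace (matrix_inv (first_form G F x) ** second_form G F N x)"

section \<open>The form \<open>i\<partial>\<partial>'f\<close> on \<open>\<complex>\<^sup>2\<close>\<close>

definition wirtinger_dz :: "2 \<Rightarrow> (complex^2 \<Rightarrow> complex) \<Rightarrow> complex^2 \<Rightarrow> complex" where
  "wirtinger_dz a f p =
     (frechet_derivative f (at p) (axis a 1) - \<i> * frechet_derivative f (at p) (axis a \<i>)) / 2"

definition wirtinger_dzbar :: "2 \<Rightarrow> (complex^2 \<Rightarrow> complex) \<Rightarrow> complex^2 \<Rightarrow> complex" where
  "wirtinger_dzbar a f p =
     (frechet_derivative f (at p) (axis a 1) + \<i> * frechet_derivative f (at p) (axis a \<i>)) / 2"

definition i_ddbar :: "(complex^2 \<Rightarrow> real) \<Rightarrow> complex^2 \<Rightarrow> complex^2 \<Rightarrow> complex^2 \<Rightarrow> complex" where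
  "i_ddbar f p X Y = \<i> * (\<Sum>a\<in>UNIV. \<Sum>b\<in>UNIV.
     wirtinger_dz a (wirtinger_dzbar b (\<lambda>q. complex_of_real (f q))) p *
     (X $ a * cnj (Y $ b) - Y $ a * cnj (X $ b)))"

section \<open>The Eguchi--Hanson space\<close>

definition eh_rel :: "complex \<times> complex \<times> complex \<Rightarrow> complex \<times> complex \<times> complex \<Rightarrow> bool" where
  "eh_rel = (\<lambda>(\<alpha>, \<beta>, \<gamma>) (\<alpha>', \<beta>', \<gamma>'). (\<alpha>, \<beta>) \<noteq> (0, 0) \<and>
     (\<exists>A. A \<noteq> 0 \<and> \<alpha>' = A * \<alpha> \<and> \<beta>' = A * \<beta> \<and> \<gamma>' = \<gamma> / A\<^sup>2))"

quotient_type eguchi_hanson = "complex \<times> complex \<times> complex" / partial: eh_rel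
proof (rule part_equivpI)
  show "\<exists>x. eh_rel x x"
    by (rule exI[of _ "(1, 1, 0)"]) (auto simp: eh_rel_def intro: exI[of _ 1])
  show "symp eh_rel"
  proof (rule sympI)
    fix x y assume "eh_rel x y"
    then obtain \<alpha> \<beta> \<gamma> A where "(\<alpha>, \<beta>) \<noteq> (0, 0)" "A \<noteq> 0" "x = (\<alpha>, \<beta>, \<gamma>)"
      "y = (A * \<alpha>, A * \<beta>, \<gamma> / A\<^sup>2)"
      by (auto simp: eh_rel_def split: prod.splits)
    then show "eh_rel y x"
      by (auto simp: eh_rel_def power_divide intro!: exI[of _ "1 / A"])
  qed
  show "transp eh_rel"
  proof (rule transpI)
    fix x y z assume "eh_rel x y" "eh_rel y z"
    then obtain \<alpha> \<beta> \<gamma> A B where "(\<alpha>, \<beta>) \<noteq> (0, 0)" "A \<noteq> 0" "B \<noteq> 0" "x = (\<alpha>, \<beta>, \<gamma>)"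
      "z = (B * (A * \<alpha>), B * (A * \<beta>), \<gamma> / A\<^sup>2 / B\<^sup>2)"
      by (auto simp: eh_rel_def split: prod.splits)
    then show "eh_rel x z"
      by (auto simp: eh_rel_def power_mult_distrib intro!: exI[of _ "B * A"])
  qed
qed

lift_definition eh_proj :: "eguchi_hanson \<Rightarrow> complex option" is
  "\<lambda>(\<alpha>, \<beta>, \<gamma>). if \<beta> = 0 then None else Some (\<alpha> / \<beta>)"
  by (auto simp: eh_rel_def)

text \<open>
  \<open>\<complex>\<^sup>2 - {0} \<rightarrow> M\<^sup>4\<close>, \<open>z \<mapsto> [z\<^sub>1, z\<^sub>2, 1]\<close>, is the two-to-one map inverting
  \<open>[\<alpha>, \<beta>, \<gamma>] \<mapsto> \<plusminus>(\<alpha> \<surd>\<gamma>, \<beta> \<surd>\<gamma>)\<close>.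
\<close>

definition eh_cover :: "complex^2 \<Rightarrow> eguchi_hanson" where
  "eh_cover z = abs_eguchi_hanson (z $ 1, z $ 2, 1)"

lift_definition eh_u1 :: "eguchi_hanson \<Rightarrow> real" is
  "\<lambda>(\<alpha>, \<beta>, \<gamma>). (cmod (\<alpha> * csqrt \<gamma>))\<^sup>2 + (cmod (\<beta> * csqrt \<gamma>))\<^sup>2"
proof -
  have c: "(cmod (csqrt z))\<^sup>2 = cmod z" for z
    by (metis norm_power power2_csqrt)
  show "(case x of (\<alpha>, \<beta>, \<gamma>) \<Rightarrow> (cmod (\<alpha> * csqrt \<gamma>))\<^sup>2 + (cmod (\<beta> * csqrt \<gamma>))\<^sup>2) =
      (case y of (\<alpha>, \<beta>, \<gamma>) \<Rightarrow> (cmod (\<alpha> * csqrt \<gamma>))\<^sup>2 + (cmod (\<beta> * csqrt \<gamma>))\<^sup>2)"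
    if "eh_rel x y" for x y
    using that by (auto simp: eh_rel_def norm_mult power_mult_distrib c norm_divide norm_power)
qed

lemma eh_u1_cover:
  assumes "z \<noteq> 0"
  shows "eh_u1 (eh_cover z) = (cmod (z $ 1))\<^sup>2 + (cmod (z $ 2))\<^sup>2"
proof -
  have "eh_rel (z $ 1, z $ 2, 1) (z $ 1, z $ 2, 1)"
    using assms by (auto simp: eh_rel_def vec_eq_iff forall_2 intro!: exI[of _ 1])
  then show ?thesis
    unfolding eh_cover_def by (subst eh_u1.abs_eq) auto
qed

definition eh_potential :: "real \<Rightarrow> eguchi_hanson \<Rightarrow> real" where
  "eh_potential t P =
     sqrt ((eh_u1 P)\<^sup>2 + t^4) + t\<^sup>2 * ln (eh_u1 P / (sqrt ((eh_u1 P)\<^sup>2 + t^4) + t\<^sup>2))"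

text \<open>
  The holomorphic chart \<open>(\<zeta>, w) \<mapsto> [\<zeta>, 1, w]\<close> covers everything except the fibre over \<open>\<infinity>\<close>; the
  zero section is \<open>w = 0\<close>, and the points \<open>\<plusminus>(z\<^sub>1, z\<^sub>2)\<close> with \<open>z\<^sub>2 \<noteq> 0\<close> have the coordinates
  \<open>(z\<^sub>1 / z\<^sub>2, z\<^sub>2\<^sup>2)\<close>.
\<close>

lift_definition eh_chart :: "complex^2 \<Rightarrow> eguchi_hanson" is "\<lambda>q. (q $ 1, 1, q $ 2)"
  by (auto simp: eh_rel_def intro!: exI[of _ 1])

lemma eh_proj_chart: "eh_proj (eh_chart q) = Some (q $ 1)"
  by transfer simp

lemma inj_eh_chart: "inj eh_chart"
proof (rule injI)
  fix p q assume "eh_chart p = eh_chart q"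
  then have "eh_rel (p $ 1, 1, p $ 2) (q $ 1, 1, q $ 2)" by transfer
  then show "p = q" by (auto simp: eh_rel_def vec_eq_iff forall_2)
qed

lemma range_eh_chart: "range eh_chart = {P. eh_proj P \<noteq> None}"
proof (intro equalityI subsetI)
  fix P assume "P \<in> range eh_chart"
  then show "P \<in> {P. eh_proj P \<noteq> None}"
    by (auto simp: eh_proj_chart)
next
  fix P assume "P \<in> {P. eh_proj P \<noteq> None}"
  then have "eh_proj P \<noteq> None" by simp
  then have "\<exists>q. P = eh_chart q"
  proof transfer
    fix x assume x: "eh_rel x x"
      "(case x of (\<alpha>, \<beta>, \<gamma>) \<Rightarrow> if \<beta> = 0 then None else Some (\<alpha> / \<beta>)) \<noteq> None"
    obtain \<alpha> \<beta> \<gamma> where [simp]: "x = (\<alpha>, \<beta>, \<gamma>)" by (cases x)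
    have "\<beta> \<noteq> 0" using x(2) by (auto split: if_splits)
    then show "\<exists>q::complex^2. eh_rel x (q $ 1, 1, q $ 2)"
      by (intro exI[of _ "vector [\<alpha> / \<beta>, \<gamma> * \<beta>\<^sup>2]"])
         (auto simp: eh_rel_def power_divide intro!: exI[of _ "1 / \<beta>"])
  qed
  then show "P \<in> range eh_chart" by auto
qed

definition cover_coords :: "complex^2 \<Rightarrow> complex^2" where
  "cover_coords z = vector [z $ 1 / z $ 2, (z $ 2)\<^sup>2]"

lemma eh_chart_cover_coords:
  assumes "z $ 2 \<noteq> 0"
  shows "eh_chart (cover_coords z) = eh_cover z"
proof -
  have "eh_rel (z $ 1, z $ 2, 1) (z $ 1 / z $ 2, 1, (z $ 2)\<^sup>2)"
    using assms by (auto simp: eh_rel_def power_divide intro!: exI[of _ "1 / z $ 2"])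
  then have "abs_eguchi_hanson (z $ 1, z $ 2, 1) = abs_eguchi_hanson (z $ 1 / z $ 2, 1, (z $ 2)\<^sup>2)"
    by (simp add: Quotient3_rel_abs[OF Quotient3_eguchi_hanson])
  then show ?thesis
    by (simp add: eh_cover_def cover_coords_def eh_chart.abs_eq)
qed

text \<open>
  The metric \<open>g\<^sub>t(X, Y) = \<omega>\<^sub>t(X, JY)\<close> in this chart. The potential is only defined off the zero
  section; on the zero section the metric is the continuous extension.
\<close>

definition eh_metric_M4 :: "real \<Rightarrow> complex^2 \<Rightarrow> complex^2 \<Rightarrow> complex^2 \<Rightarrow> real" where
  "eh_metric_M4 t q X Y =
     Re (i_ddbar (\<lambda>q. eh_potential t (eh_chart q)) q X (\<chi> a. \<i> * Y $ a))"

definition eh_metric :: "real \<Rightarrow> complex^2 \<Rightarrow> complex^2 \<Rightarrow> complex^2 \<Rightarrow> real" where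
  "eh_metric t q X Y =
     (if q $ 2 \<noteq> 0 then eh_metric_M4 t q X Y
      else Lim (at q within {q. q $ 2 \<noteq> 0}) (\<lambda>q. eh_metric_M4 t q X Y))"

section \<open>The hypersurface\<close>

definition smooth_curve_on :: "real set \<Rightarrow> (real \<Rightarrow> complex) \<Rightarrow> bool" where
  "smooth_curve_on I \<Gamma> \<longleftrightarrow> (\<exists>D :: nat \<Rightarrow> real \<Rightarrow> complex. D 0 = \<Gamma> \<and>
     (\<forall>n. \<forall>s\<in>I. (D n has_vector_derivative D (Suc n) s) (at s)))"

text \<open>
  \<open>M\<^sup>3\<^sub>\<Gamma>\<close> may have self-intersections, so fields along it are functions of the parameter
  \<open>x = (s, Re w, Im w)\<close> of the point \<open>[\<Gamma>(s), 1, w]\<close>; the zero section \<open>w = 0\<close> is included.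
\<close>

definition M3 :: "real set \<Rightarrow> (real \<Rightarrow> complex) \<Rightarrow> eguchi_hanson set" where
  "M3 I \<Gamma> = {P. eh_proj P \<in> Some ` \<Gamma> ` I}"

definition M3_coords :: "(real \<Rightarrow> complex) \<Rightarrow> real^3 \<Rightarrow> complex^2" where
  "M3_coords \<Gamma> x = vector [\<Gamma> (x $ 1), Complex (x $ 2) (x $ 3)]"

lemma M3_eq_image: "M3 I \<Gamma> = (\<lambda>x. eh_chart (M3_coords \<Gamma> x)) ` {x. x $ 1 \<in> I}"
proof -
  show ?thesis
  proof (intro equalityI subsetI)
    fix P assume P: "P \<in> M3 I \<Gamma>"
    then have "P \<in> range eh_chart"
      unfolding range_eh_chart by (auto simp: M3_def)
    then obtain q where q: "P = eh_chart q" by auto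
    with P obtain s where s: "s \<in> I" "q $ 1 = \<Gamma> s"
      by (auto simp: M3_def eh_proj_chart)
    have "q = M3_coords \<Gamma> (vector [s, Re (q $ 2), Im (q $ 2)])"
      using s by (simp add: M3_coords_def vec_eq_iff forall_2)
    with s show "P \<in> (\<lambda>x. eh_chart (M3_coords \<Gamma> x)) ` {x. x $ 1 \<in> I}"
      unfolding q by (intro image_eqI[where x = "vector [s, Re (q $ 2), Im (q $ 2)]"]) auto
  qed (auto simp: M3_def eh_proj_chart M3_coords_def)
qed

definition M3_polar :: "(real \<Rightarrow> complex) \<Rightarrow> real \<Rightarrow> real \<Rightarrow> real \<Rightarrow> complex^2" where
  "M3_polar \<Gamma> s \<rho> \<phi> = vector [of_real \<rho> * cis \<phi> * \<Gamma> s, of_real \<rho> * cis \<phi>]"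

definition polar_params :: "real \<Rightarrow> real \<Rightarrow> real \<Rightarrow> real^3" where
  "polar_params s \<rho> \<phi> = vector [s, \<rho>\<^sup>2 * cos (2 * \<phi>), \<rho>\<^sup>2 * sin (2 * \<phi>)]"

lemma eh_chart_polar_params:
  assumes "\<rho> > 0"
  shows "eh_chart (M3_coords \<Gamma> (polar_params s \<rho> \<phi>)) = eh_cover (M3_polar \<Gamma> s \<rho> \<phi>)"
proof -
  have "Complex (\<rho>\<^sup>2 * cos (2 * \<phi>)) (\<rho>\<^sup>2 * sin (2 * \<phi>)) = (of_real \<rho> * cis \<phi>)\<^sup>2"
    by (simp add: complex_eq_iff power2_eq_square cos_double sin_double right_diff_distrib)
  then have "M3_coords \<Gamma> (polar_params s \<rho> \<phi>) = cover_coords (M3_polar \<Gamma> s \<rho> \<phi>)"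
    using assms by (simp add: M3_coords_def polar_params_def cover_coords_def M3_polar_def)
  then show ?thesis
    using assms by (simp add: eh_chart_cover_coords M3_polar_def)
qed

text \<open>
  The unit normal in the coordinates \<open>(z\<^sub>1, z\<^sub>2)\<close>, for \<open>\<Gamma> = r e\<^sup>i\<^sup>\<theta>\<close>. At zeros of \<open>\<Gamma>\<close> the derivatives
  of \<open>r\<close> and \<open>\<theta>\<close> need not exist, but they only enter multiplied by \<open>r = 0\<close>, in accordance with
  the smooth functions \<open>r r' = u u' + v v'\<close> and \<open>r\<^sup>2 \<theta>' = u v' - v u'\<close>.
\<close>

definition normal_polar ::
  "real \<Rightarrow> (real \<Rightarrow> complex) \<Rightarrow> (real \<Rightarrow> real) \<Rightarrow> real \<Rightarrow> real \<Rightarrow> real \<Rightarrow> complex^2" where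
  "normal_polar t \<Gamma> \<theta> s \<rho> \<phi> =
    (let r = cmod (\<Gamma> s);
         u' = deriv (\<lambda>s. Re (\<Gamma> s)) s; v' = deriv (\<lambda>s. Im (\<Gamma> s)) s;
         r' = deriv (\<lambda>s. cmod (\<Gamma> s)) s; \<theta>' = deriv \<theta> s;
         K = 2 * \<rho>\<^sup>2 * (r\<^sup>2 + 1) / sqrt (\<rho>^4 * (r\<^sup>2 + 1)\<^sup>2 + t^4);
         w1 = v' * cos \<phi> + u' * sin \<phi>;
         w2 = u' * cos \<phi> - v' * sin \<phi>;
         w3 = r' * sin \<phi> + r * \<theta>' * cos \<phi>;
         w4 = r' * cos \<phi> - r * \<theta>' * sin \<phi>
     in (1 / 2 * sqrt (K / (r\<^sup>2 + 1))) *\<^sub>R vector [Complex w1 (- w2), Complex (- r * w3) (r * w4)])"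

text \<open>
  The same field in the chart \<open>(\<zeta>, w)\<close>: the push-forward under the double cover, which does not
  depend on the choice of \<open>(\<rho>, \<phi>)\<close> over the given point, and its continuous extension to the
  zero section.
\<close>

definition M3_normal_M4 ::
  "real \<Rightarrow> (real \<Rightarrow> complex) \<Rightarrow> (real \<Rightarrow> real) \<Rightarrow> real^3 \<Rightarrow> complex^2" where
  "M3_normal_M4 t \<Gamma> \<theta> x = (THE V. \<forall>\<rho> \<phi>. \<rho> > 0 \<longrightarrow>
     eh_cover (M3_polar \<Gamma> (x $ 1) \<rho> \<phi>) = eh_chart (M3_coords \<Gamma> x) \<longrightarrow>
     V = frechet_derivative cover_coords (at (M3_polar \<Gamma> (x $ 1) \<rho> \<phi>))
           (normal_polar t \<Gamma> \<theta> (x $ 1) \<rho> \<phi>))"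

definition M3_normal ::
  "real \<Rightarrow> (real \<Rightarrow> complex) \<Rightarrow> (real \<Rightarrow> real) \<Rightarrow> real^3 \<Rightarrow> complex^2" where
  "M3_normal t \<Gamma> \<theta> x =
     (let Z = {x. Complex (x $ 2) (x $ 3) \<noteq> 0}
      in if x \<in> Z then M3_normal_M4 t \<Gamma> \<theta> x else Lim (at x within Z) (M3_normal_M4 t \<Gamma> \<theta>))"

definition M3_mean_curvature ::
  "real \<Rightarrow> (real \<Rightarrow> complex) \<Rightarrow> (real \<Rightarrow> real) \<Rightarrow> real^3 \<Rightarrow> real" where
  "M3_mean_curvature t \<Gamma> \<theta> = mean_curvature (eh_metric t) (M3_coords \<Gamma>) (M3_normal t \<Gamma> \<theta>)"

definition M3_minimal :: "real \<Rightarrow> real set \<Rightarrow> (real \<Rightarrow> complex) \<Rightarrow> (real \<Rightarrow> real) \<Rightarrow> bool" where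
  "M3_minimal t I \<Gamma> \<theta> \<longleftrightarrow> (\<forall>x. x $ 1 \<in> I \<longrightarrow> M3_mean_curvature t \<Gamma> \<theta> x = 0)"

section \<open>Curves in the round sphere\<close>

definition k_g :: "(real \<Rightarrow> complex) \<Rightarrow> real \<Rightarrow> real" where
  "k_g \<Gamma> s =
    (let u = (\<lambda>s. Re (\<Gamma> s)); v = (\<lambda>s. Im (\<Gamma> s)); r = cmod (\<Gamma> s)
     in 1 / 2 * ((deriv u s * deriv (deriv v) s - deriv v s * deriv (deriv u) s) * (r\<^sup>2 + 1)
                 - 2 * (u s * deriv v s - v s * deriv u s)))"

definition round_metric :: "complex \<Rightarrow> complex \<Rightarrow> complex \<Rightarrow> real" where
  "round_metric p X Y = 4 * (X \<bullet> Y) / (1 + (Re p)\<^sup>2 + (Im p)\<^sup>2)\<^sup>2"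

text \<open>
  Geodesic curvature of a regular curve with respect to a conformal metric \<open>G\<close> on \<open>\<complex>\<close> and the
  standard orientation of \<open>\<complex>\<close>: \<open>\<i> c'\<close> is the normal direction to the left of the curve.
\<close>

definition geodesic_curvature ::
  "(complex \<Rightarrow> complex \<Rightarrow> complex \<Rightarrow> real) \<Rightarrow> (real \<Rightarrow> complex) \<Rightarrow> real \<Rightarrow> real" where
  "geodesic_curvature G c s =
    (let c' = (\<lambda>s. vector_derivative c (at s));
         \<nu> = (\<i> * c' s) /\<^sub>R sqrt (G (c s) (\<i> * c' s) (\<i> * c' s))
     in G (c s) (covariant_derivative G c c' s 1) \<nu> / G (c s) (c' s) (c' s))"

text \<open>Inverse stereographic projection, with \<open>\<infinity>\<close> at the north pole.\<close>

definition inv_stereo :: "complex \<Rightarrow> real^3" where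
  "inv_stereo p = (1 / (1 + (cmod p)\<^sup>2)) *\<^sub>R vector [2 * Re p, 2 * Im p, (cmod p)\<^sup>2 - 1]"

definition great_circle :: "(real^3) set \<Rightarrow> bool" where
  "great_circle C \<longleftrightarrow> (\<exists>a. a \<noteq> 0 \<and> C = {y \<in> sphere 0 1. a \<bullet> y = 0})"

end

theory Submission
  imports Defs
begin

text \<open>
  In the chart \<open>(\<zeta>, w)\<close> the metric is \<open>2 L / P\<^sup>2 \<bar>d\<zeta>\<bar>\<^sup>2 + 2 / L \<bar>\<eta>\<bar>\<^sup>2\<close> with \<open>P = 1 + \<bar>\<zeta>\<bar>\<^sup>2\<close>,
  \<open>L = \<surd>(\<bar>w\<bar>\<^sup>2 P\<^sup>2 + t\<^sup>4)\<close> and \<open>\<eta> = P dw / 2 + w \<zeta>' d\<zeta>\<close>, \<open>\<zeta>'\<close> denoting the conjugate of \<open>\<zeta>\<close>. The unit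
  normal becomes \<open>(- \<i> P \<Gamma>\<^sub>s, 2 \<i> w \<Gamma>' \<Gamma>\<^sub>s) / \<surd>(2 L)\<close>; it is annihilated by \<open>\<eta>\<close>, so it is a multiple of
  \<open>\<i>\<close> times the tangent vector \<open>E\<close> orthogonal to the fibre. In an orthogonal frame made of \<open>E\<close> and two
  vectors along the fibre, the fibre directions contribute zero to the trace (fibres are complex
  curves), and the contribution of \<open>E\<close> is the asserted multiple of \<open>k\<^sub>g\<close>. Everything extends smoothly
  to the zero section \<open>w = 0\<close>.

  If \<open>k\<^sub>g = 0\<close>, the cross product of the spherical curve with its unit tangent is constant, so the
  curve lies in the plane orthogonal to it. Conversely, differentiating the equation of a plane
  through the origin twice along \<open>\<Gamma>\<close> gives a linear system with determinant \<open>- 2 k\<^sub>g\<close>.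
\<close>

section \<open>The Levi-Civita connection\<close>

text \<open>Linearity and symmetry are asked at every \<open>q\<close>, because the derivative at
  \<open>p\<close> compares the forms at nearby points and must inherit both properties; positivity
  is asked at \<open>p\<close>, where vectors are recovered from their pairings.\<close>

locale metric_at =
  fixes G :: "'a::euclidean_space \<Rightarrow> 'a \<Rightarrow> 'a \<Rightarrow> real" and p :: 'a
  assumes linear: "linear (G q X)"
    and sym: "G q X Y = G q Y X"
    and pos: "X \<noteq> 0 \<Longrightarrow> G p X X > 0"
    and differentiable: "(\<lambda>q. G q X Y) differentiable (at p)"
begin

abbreviation DG :: "'a \<Rightarrow> 'a \<Rightarrow> 'a \<Rightarrow> real" where
  "DG X Y Z \<equiv> frechet_derivative (\<lambda>q. G q Y Z) (at p) X"

lemma linear_left: "linear (\<lambda>X. G q X Y)"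
proof -
  have "(\<lambda>X. G q X Y) = G q Y"
    by (rule ext) (rule sym)
  then show ?thesis
    using linear[of q Y] by simp
qed

lemmas add_right = linear_add[OF linear] and scale_right = linear_cmul[OF linear]
  and add_left = linear_add[OF linear_left] and scale_left = linear_cmul[OF linear_left]

lemma has_derivative: "((\<lambda>q. G q Y Z) has_derivative (\<lambda>X. DG X Y Z)) (at p)"
  using differentiable frechet_derivative_works by blast

lemma DG_sym: "DG X Y Z = DG X Z Y"
  by (simp add: sym)

lemma DG_linear: "linear (\<lambda>X. DG X Y Z)"
  using linear_frechet_derivative[OF differentiable] .

lemma DG_add_right: "DG X Y (Z + W) = DG X Y Z + DG X Y W"
proof -
  have "((\<lambda>q. G q Y (Z + W)) has_derivative (\<lambda>X. DG X Y Z + DG X Y W)) (at p)"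
    unfolding add_right by (intro has_derivative_add has_derivative)
  from frechet_derivative_at[OF this, symmetric] show ?thesis
    by simp
qed

lemma DG_scale_right: "DG X Y (c *\<^sub>R Z) = c * DG X Y Z"
proof -
  have "((\<lambda>q. G q Y (c *\<^sub>R Z)) has_derivative (\<lambda>X. c *\<^sub>R DG X Y Z)) (at p)"
    unfolding scale_right by (intro has_derivative_scaleR_right has_derivative)
  from frechet_derivative_at[OF this, symmetric] show ?thesis
    by simp
qed

lemma DG_linear_right: "linear (DG X Y)"
  by (rule linearI) (simp_all add: DG_add_right DG_scale_right)

lemma DG_linear_mid: "linear (\<lambda>Y. DG X Y Z)"
proof -
  have "(\<lambda>Y. DG X Y Z) = DG X Z"
    by (rule ext) (rule DG_sym)
  then show ?thesis
    using DG_linear_right[where X = X and Y = Z] by (simp only:)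
qed

text \<open>Test with \<open>Z = X - Y\<close>: the square length of the difference vanishes,
  against positivity.\<close>

lemma nondegenerate:
  assumes "\<And>Z. G p X Z = G p Y Z"
  shows "X = Y"
proof (rule ccontr)
  assume "X \<noteq> Y"
  then have "G p (X - Y) (X - Y) > 0"
    using pos by simp
  moreover have "G p (X - Y) (X - Y) = 0"
    using assms linear_diff[OF linear_left] by simp
  ultimately show False
    by simp
qed

text \<open>Riesz representation for \<open>G p\<close> instead of the Euclidean product. It
  produces Christoffel vectors from their prescribed pairings.\<close>

lemma riesz:
  fixes \<phi> :: "'a \<Rightarrow> real"
  assumes "linear \<phi>"
  obtains V where "\<And>Z. G p V Z = \<phi> Z"
proof -
  \<comment> \<open>\<open>T V\<close> represents the functional \<open>G p V\<close> in the
    Euclidean product. It is injective by nondegeneracy, hence onto in finite dimension.\<close>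
  define T where "T V = (\<Sum>b\<in>Basis. G p V b *\<^sub>R b)" for V
  have T_inner: "T V \<bullet> b = G p V b" if "b \<in> Basis" for V b
    using that by (simp add: T_def inner_sum_left inner_Basis if_distrib cong: if_cong)
  have lin: "linear T"
    unfolding T_def
    by (rule linearI)
      (simp_all add: add_left scale_left sum.distrib scaleR_sum_right scaleR_add_left)
  have ext: "f Z = g Z" if "linear f" "linear g" "\<And>b. b \<in> Basis \<Longrightarrow> f b = g b"
    for f g :: "'a \<Rightarrow> real" and Z
    using linear_eq_on[OF that(1,2), of Z Basis] that(3) by simp
  have "inj T"
    unfolding linear_injective_0[OF lin]
  proof (intro allI impI)
    fix V assume V: "T V = 0"
    have "G p V Z = G p 0 Z" for Z
      by (rule ext[OF linear linear])
         (metis T_inner V inner_zero_left linear_0[OF linear_left])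
    then show "V = 0"
      by (rule nondegenerate)
  qed
  then obtain V where V: "T V = (\<Sum>b\<in>Basis. \<phi> b *\<^sub>R b)"
    using linear_injective_imp_surjective[OF lin] by (metis surjD)
  have "G p V b = \<phi> b" if "b \<in> Basis" for b
    using that unfolding T_inner[OF that, symmetric] V
    by (simp add: inner_sum_left inner_Basis if_distrib cong: if_cong)
  then have "G p V Z = \<phi> Z" for Z
    by (rule ext[OF linear assms])
  then show thesis
    by (rule that)
qed

text \<open>The Koszul formula for constant fields, whose Lie brackets vanish.\<close>

definition koszul :: "'a \<Rightarrow> 'a \<Rightarrow> 'a \<Rightarrow> real" where
  "koszul X Y Z = (DG X Y Z + DG Y X Z - DG Z X Y) / 2"

definition is_connection :: "('a \<Rightarrow> 'a \<Rightarrow> 'a) \<Rightarrow> bool" where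
  "is_connection B \<longleftrightarrow> (\<forall>X Y. B X Y = B Y X) \<and> (\<forall>X Y Z. DG X Y Z = G p (B X Y) Z + G p Y (B X Z))"

text \<open>Combining the metric condition for the three cyclic placements of the arguments,
  symmetry of \<open>B\<close> cancels all terms except twice the wanted one.\<close>

lemma is_connection_koszul:
  assumes "is_connection B"
  shows "G p (B X Y) Z = koszul X Y Z"
proof -
  have s: "B X Y = B Y X" and m: "DG X Y Z = G p (B X Y) Z + G p Y (B X Z)" for X Y Z
    using assms by (auto simp: is_connection_def)
  show ?thesis
    unfolding koszul_def m by (simp add: s[of Y X] s[of Z X] s[of Z Y] sym)
qed

text \<open>The description by \<open>THE\<close> is meaningful only once unique existence is known.
  Existence represents the Koszul expression by \<open>riesz\<close>; uniqueness holds because the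
  Koszul formula fixes all pairings.\<close>

lemma is_connection_levi_civita: "is_connection (levi_civita G p)"
proof -
  have "\<exists>!B. is_connection B"
  proof (rule ex_ex1I)
    have "linear (koszul X Y)" for X Y
      unfolding koszul_def
      using DG_linear_right[of X Y] DG_linear_right[of Y X] DG_linear[of X Y]
      by (auto simp: linear_iff algebra_simps add_divide_distrib diff_divide_distrib)
    then have "\<exists>V. \<forall>Z. G p V Z = koszul X Y Z" for X Y
      by (metis riesz)
    then obtain B where B: "\<And>X Y Z. G p (B X Y) Z = koszul X Y Z"
      by metis
    have "B X Y = B Y X" for X Y
      by (rule nondegenerate) (simp add: B koszul_def DG_sym)
    moreover have "DG X Y Z = G p (B X Y) Z + G p Y (B X Z)" for X Y Z
      using DG_sym[of X Z Y] DG_sym[of Z Y X] DG_sym[of Y Z X]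
      unfolding sym[of p Y "B X Z"] B koszul_def by argo
    ultimately show "\<exists>B. is_connection B"
      by (auto simp: is_connection_def)
  next
    fix B B' assume "is_connection B" "is_connection B'"
    then have "B X Y = B' X Y" for X Y
      by (intro nondegenerate) (simp add: is_connection_koszul)
    then show "B = B'"
      by blast
  qed
  then show ?thesis
    unfolding levi_civita_def is_connection_def by (rule theI')
qed

lemma levi_civita_koszul:
  "G p (levi_civita G p X Y) Z = (DG X Y Z + DG Y X Z - DG Z X Y) / 2"
  using is_connection_koszul[OF is_connection_levi_civita] by (simp add: koszul_def)

text \<open>With \<open>Z = X\<close> two of the three Koszul terms cancel, so diagonal entries of
  the second fundamental form can be found without Christoffel symbols.\<close>

lemma levi_civita_diag: "G p X (levi_civita G p X Y) = DG Y X X / 2"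
  by (simp add: levi_civita_koszul sym[of p X] DG_sym)

lemma linear_levi_civita: "linear (\<lambda>X. levi_civita G p X Y)"
proof (rule linearI)
  show "levi_civita G p (X + X') Y = levi_civita G p X Y + levi_civita G p X' Y" for X X'
  proof (rule nondegenerate)
    fix Z
    show "G p (levi_civita G p (X + X') Y) Z = G p (levi_civita G p X Y + levi_civita G p X' Y) Z"
      unfolding add_left[where q = p] levi_civita_koszul linear_add[OF DG_linear]
        linear_add[OF DG_linear_mid] by argo
  qed
  show "levi_civita G p (c *\<^sub>R X) Y = c *\<^sub>R levi_civita G p X Y" for c X
  proof (rule nondegenerate)
    fix Z
    show "G p (levi_civita G p (c *\<^sub>R X) Y) Z = G p (c *\<^sub>R levi_civita G p X Y) Z"
      unfolding scale_left[where q = p] levi_civita_koszul linear_cmul[OF DG_linear]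
        linear_cmul[OF DG_linear_mid] real_scaleR_def by (simp add: algebra_simps)
  qed
qed

end

section \<open>The trace in an orthogonal frame\<close>

text \<open>The columns of \<open>M\<close> are orthonormal for \<open>h\<close>, hence the inverse
  of \<open>h\<close> is \<open>M ** transpose M\<close>; the claim follows from cyclicity of the
  trace.\<close>

lemma trace_matrix_inv_orthonormal:
  fixes h S M :: "real^'n^'n"
  assumes "transpose M ** h ** M = mat 1"
  shows "trace (matrix_inv h ** S) = trace (transpose M ** S ** M)"
proof -
  have left: "(transpose M ** h) ** M = mat 1"
    using assms .
  then have "M ** (transpose M ** h) = mat 1"
    using matrix_left_right_inverse by blast
  then have inv_left: "(M ** transpose M) ** h = mat 1"
    by (simp add: matrix_mul_assoc)
  then have inv_right: "h ** (M ** transpose M) = mat 1"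
    using matrix_left_right_inverse by blast
  have "matrix_inv h = M ** transpose M"
    unfolding matrix_inv_def
  proof (rule some_equality)
    fix A assume "h ** A = mat 1 \<and> A ** h = mat 1"
    then show "A = M ** transpose M"
      using inv_left by (metis matrix_mul_assoc matrix_mul_lid matrix_mul_rid)
  qed (use inv_left inv_right in simp)
  then show ?thesis
    by (metis matrix_mul_assoc trace_mul_sym)
qed

lemma linear_expand_axis:
  fixes f :: "real^'n \<Rightarrow> real"
  assumes "linear f"
  shows "(\<Sum>i\<in>UNIV. v $ i * f (axis i 1)) = f v"
proof -
  have "f v = f (\<Sum>i\<in>UNIV. v $ i *\<^sub>R axis i 1)"
    using basis_expansion[of v] by (simp add: scalar_mult_eq_scaleR)
  then show ?thesis
    by (simp add: linear_sum[OF assms] linear_cmul[OF assms])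
qed

lemma congruence_matrix_nth:
  fixes \<beta> :: "real^'n \<Rightarrow> real^'n \<Rightarrow> real"
  assumes "\<And>a. linear (\<beta> a)" and "\<And>b. linear (\<lambda>a. \<beta> a b)"
  shows "(transpose M ** (\<chi> i j. \<beta> (axis i 1) (axis j 1)) ** M) $ k $ l =
    \<beta> (column k M) (column l M)"
proof -
  have "\<beta> (column k M) (column l M) =
      (\<Sum>j\<in>UNIV. M $ j $ l * (\<Sum>i\<in>UNIV. M $ i $ k * \<beta> (axis i 1) (axis j 1)))"
    using linear_expand_axis[OF assms(1), of "column l M" "column k M"]
      linear_expand_axis[OF assms(2), of "column k M"]
    by (simp add: column_def)
  then show ?thesis
    by (simp add: matrix_matrix_mult_def transpose_def mult.commute)
qed

text \<open>
  With \<open>\<nabla> = D + B\<close>, the diagonal entries of the second fundamental form only involve the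
  derivative of the metric in the normal direction, since \<open>g(X, B(X, N)) = (D\<^sub>N g)(X, X) / 2\<close>.
\<close>

lemma mean_curvature_orthogonal_frame:
  fixes F N :: "real^'n \<Rightarrow> 'a::euclidean_space" and e :: "'n \<Rightarrow> real^'n"
  assumes "metric_at G (F x)"
    and F: "(F has_derivative F') (at x)" and N: "(N has_derivative N') (at x)"
    and ortho: "\<And>i j. G (F x) (F' (e i)) (F' (e j)) = (if i = j then c i else 0)"
    and c: "\<And>i. c i > 0"
  shows "mean_curvature G F N x = (\<Sum>k\<in>UNIV. (G (F x) (F' (e k)) (N' (e k)) +
    frechet_derivative (\<lambda>q. G q (F' (e k)) (F' (e k))) (at (F x)) (N x) / 2) / c k)"
proof -
  interpret metric_at G "F x" by fact
  \<comment> \<open>The columns are the frame vectors normalised to unit length, \<open>c k\<close>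
    being their squared lengths.\<close>
  define M :: "real^'n^'n" where "M = (\<chi> i k. e k $ i / sqrt (c k))"
  define A where "A b = N' b + levi_civita G (F x) (F' b) (N x)" for b
  have col: "column k M = (1 / sqrt (c k)) *\<^sub>R e k" for k
    by (simp add: M_def column_def vec_eq_iff)
  have F'_lin: "linear F'" and N'_lin: "linear N'"
    using F N by (auto intro: has_derivative_linear)
  have A_lin: "linear A"
    unfolding A_def
    using linear_compose_add[OF N'_lin linear_compose[OF F'_lin linear_levi_civita]]
    by (simp add: o_def)
  have bil: "linear (\<lambda>b. G (F x) (F' a) (T b))" "linear (\<lambda>a. G (F x) (F' a) (T b))"
    if "linear T" for T :: "real^'n \<Rightarrow> 'a" and a b
    using linear_compose[OF that linear] linear_compose[OF F'_lin linear_left]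
    by (simp_all add: o_def)
  have entry: "G (F x) (F' (column k M)) (T (column l M)) =
      G (F x) (F' (e k)) (T (e l)) / (sqrt (c k) * sqrt (c l))"
    if "linear T" for T :: "real^'n \<Rightarrow> 'a" and k l
    unfolding col linear_cmul[OF that] linear_cmul[OF F'_lin] scale_left scale_right
    by simp
  have h: "first_form G F x = (\<chi> i j. G (F x) (F' (axis i 1)) (F' (axis j 1)))"
    by (simp add: first_form_def frechet_derivative_at[OF F, symmetric])
  have S: "second_form G F N x = (\<chi> i j. G (F x) (F' (axis i 1)) (A (axis j 1)))"
    by (simp add: second_form_def covariant_derivative_def A_def
        frechet_derivative_at[OF F, symmetric] frechet_derivative_at[OF N, symmetric])
  have "transpose M ** first_form G F x ** M = mat 1"
    unfolding vec_eq_iff h congruence_matrix_nth[OF bil[OF F'_lin]] entry[OF F'_lin] ortho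
    using c by (auto simp: mat_def less_imp_le less_imp_neq[symmetric])
  then have "mean_curvature G F N x = trace (transpose M ** second_form G F N x ** M)"
    unfolding mean_curvature_def by (rule trace_matrix_inv_orthonormal)
  also have "\<dots> = (\<Sum>k\<in>UNIV. G (F x) (F' (e k)) (A (e k)) / c k)"
    unfolding trace_def S congruence_matrix_nth[OF bil[OF A_lin]] entry[OF A_lin]
    using c by (simp add: less_imp_le)
  finally show ?thesis
    by (simp add: A_def add_right levi_civita_diag)
qed

section \<open>The Eguchi--Hanson metric in the chart\<close>

lemma has_derivative_vector_2:
  fixes f g :: "'a::real_normed_vector \<Rightarrow> complex"
  assumes "(f has_derivative f') F" and "(g has_derivative g') F"
  shows "((\<lambda>x. vector [f x, g x] :: complex^2) has_derivative (\<lambda>h. vector [f' h, g' h])) F"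
proof -
  have eq: "(vector [a, b] :: complex^2) = axis 1 a + axis 2 b" for a b
    by (simp add: vec_eq_iff forall_2 axis_def)
  have "bounded_linear (axis k :: complex \<Rightarrow> complex^2)" for k
    by (rule linear_conv_bounded_linear[THEN iffD1], rule linearI)
       (simp_all add: axis_def vec_eq_iff)
  note axis = bounded_linear.has_derivative[OF this]
  show ?thesis
    unfolding eq by (rule has_derivative_add[OF axis[OF assms(1)] axis[OF assms(2)]])
qed

lemma has_derivative_vec_nth_complex [derivative_intros]:
  "(f has_derivative f') F \<Longrightarrow> ((\<lambda>x. f x $ i) has_derivative (\<lambda>h. f' h $ i)) F"
  by (rule bounded_linear.has_derivative[OF bounded_linear_vec_nth])

text \<open>
  Write \<open>\<tau> = log u\<^sub>1\<close>, where \<open>u\<^sub>1 = \<bar>w\<bar> P\<close> in the chart \<open>(\<zeta>, w)\<close>. Then \<open>L\<close> is the derivative of the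
  potential with respect to \<open>\<tau>\<close>, the second derivative is \<open>u\<^sub>1\<^sup>2 / L\<close>, and \<open>\<eta>(X) = w P \<partial>\<tau>(X)\<close>. Hence
  \<open>\<partial>\<partial>'f = L \<partial>\<partial>'\<tau> + (u\<^sub>1\<^sup>2 / L) \<partial>\<tau> \<and> \<partial>'\<tau>\<close> gives \<open>eh_G\<close>, which is smooth across \<open>w = 0\<close>.
\<close>

definition eh_P :: "complex^2 \<Rightarrow> real" where
  "eh_P q = 1 + q $ 1 \<bullet> q $ 1"

definition eh_L :: "real \<Rightarrow> complex^2 \<Rightarrow> real" where
  "eh_L t q = sqrt ((q $ 2 \<bullet> q $ 2) * (eh_P q)\<^sup>2 + t^4)"

definition eh_eta :: "complex^2 \<Rightarrow> complex^2 \<Rightarrow> complex" where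
  "eh_eta q X = of_real (eh_P q / 2) * X $ 2 + q $ 2 * cnj (q $ 1) * X $ 1"

definition eh_G :: "real \<Rightarrow> complex^2 \<Rightarrow> complex^2 \<Rightarrow> complex^2 \<Rightarrow> real" where
  "eh_G t q X Y = 2 * (eh_L t q / (eh_P q)\<^sup>2 * (X $ 1 \<bullet> Y $ 1) +
     (eh_eta q X \<bullet> eh_eta q Y) / eh_L t q)"

lemma eh_eta_add: "eh_eta q (X + Y) = eh_eta q X + eh_eta q Y"
  by (simp add: eh_eta_def algebra_simps)

lemma eh_eta_scale: "eh_eta q (c *\<^sub>R X) = c *\<^sub>R eh_eta q X"
  by (simp add: eh_eta_def algebra_simps)

lemma eh_P_pos: "eh_P q > 0"
  by (simp add: eh_P_def add_pos_nonneg)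

lemma eh_L_pos: "t > 0 \<Longrightarrow> eh_L t q > 0"
  by (simp add: eh_L_def add_nonneg_pos)

section \<open>First derivatives of the closed-form metric\<close>

definition eh_dP :: "complex^2 \<Rightarrow> complex^2 \<Rightarrow> real" where
  "eh_dP q Z = 2 * (q $ 1 \<bullet> Z $ 1)"

definition eh_dL :: "real \<Rightarrow> complex^2 \<Rightarrow> complex^2 \<Rightarrow> real" where
  "eh_dL t q Z = ((q $ 2 \<bullet> Z $ 2) * (eh_P q)\<^sup>2 + (q $ 2 \<bullet> q $ 2) * eh_P q * eh_dP q Z) / eh_L t q"

definition eh_deta :: "complex^2 \<Rightarrow> complex^2 \<Rightarrow> complex^2 \<Rightarrow> complex" where
  "eh_deta q Z X = of_real (eh_dP q Z / 2) * X $ 2 +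
     (Z $ 2 * cnj (q $ 1) + q $ 2 * cnj (Z $ 1)) * X $ 1"

lemma eh_P_deriv [derivative_intros]: "(eh_P has_derivative eh_dP q) (at q)"
  unfolding eh_P_def[abs_def]
  by (rule derivative_eq_intros refl)+ (simp add: fun_eq_iff eh_dP_def inner_commute)

lemma eh_L_deriv [derivative_intros]:
  assumes "t > 0"
  shows "(eh_L t has_derivative eh_dL t q) (at q)"
proof -
  have pos: "(q $ 2 \<bullet> q $ 2) * (eh_P q)\<^sup>2 + t^4 > 0"
    using assms by (simp add: add_nonneg_pos)
  have w: "((\<lambda>q. q $ 2 \<bullet> q $ 2) has_derivative (\<lambda>Z. 2 * (q $ 2 \<bullet> Z $ 2))) (at q)"
    for q :: "complex^2"
    by (rule derivative_eq_intros refl)+ (simp add: inner_commute)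
  \<comment> \<open>The left side has the shape that the differentiation rules produce. Stated for
    abstract reals, it is plain algebra with nothing left to unfold.\<close>
  have aux: "(m * (real 2 * dP * P ^ (2 - 1)) + 2 * n * P\<^sup>2 + 0) * (inverse L / 2) =
      (n * P\<^sup>2 + m * P * dP) / L" for m n P dP L :: real
  proof -
    have "(m * (real 2 * dP * P ^ (2 - 1)) + 2 * n * P\<^sup>2 + 0) * (inverse L / 2) =
        (n * P\<^sup>2 + m * P * dP) * inverse L"
      by (simp add: algebra_simps)
    then show ?thesis
      by (simp only: divide_inverse)
  qed
  show ?thesis
    unfolding eh_L_def[abs_def]
    by (rule w pos derivative_eq_intros refl)+
      (rule ext, unfold eh_dL_def eh_L_def, rule aux)
qed

lemma eh_eta_deriv [derivative_intros]:
  "((\<lambda>q. eh_eta q X) has_derivative (\<lambda>Z. eh_deta q Z X)) (at q)"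
proof -
  have "((\<lambda>q. eh_P q / 2) has_derivative (\<lambda>Z. eh_dP q Z / 2)) (at q)"
    by (rule bounded_linear.has_derivative[OF bounded_linear_divide eh_P_deriv])
  note * = has_derivative_mult_left[OF has_derivative_of_real[OF this]]
  show ?thesis
    unfolding eh_eta_def[abs_def]
    by (rule * derivative_eq_intros refl)+ (simp add: fun_eq_iff eh_deta_def algebra_simps)
qed

lemma eh_G_deriv:
  assumes "t > 0"
  shows "((\<lambda>q. eh_G t q X Y) has_derivative (\<lambda>Z. 2 *
    ((eh_dL t q Z / (eh_P q)\<^sup>2 - 2 * eh_L t q * eh_dP q Z / (eh_P q)^3) * (X $ 1 \<bullet> Y $ 1) +
     (eh_deta q Z X \<bullet> eh_eta q Y + eh_eta q X \<bullet> eh_deta q Z Y) / eh_L t q -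
     (eh_eta q X \<bullet> eh_eta q Y) * eh_dL t q Z / (eh_L t q)\<^sup>2))) (at q)"
proof -
  have pos: "eh_P q \<noteq> 0" "eh_L t q \<noteq> 0"
    using eh_P_pos[of q] eh_L_pos[OF assms, of q] by auto
  have aux: "2 * ((- L * (inverse (P\<^sup>2) * (real 2 * dP * P ^ (2 - 1)) * inverse (P\<^sup>2)) +
      dL / P\<^sup>2) * k + (- m * (inverse L * dL * inverse L) + (n' + n) / L)) =
      2 * ((dL / P\<^sup>2 - 2 * L * dP / P ^ 3) * k + (n + n') / L - m * dL / L\<^sup>2)"
    if "P \<noteq> 0" "L \<noteq> 0" for P L dP dL k m n n' :: real
  proof -
    have eq: "inverse (P\<^sup>2) * (real 2 * dP * P ^ (2 - 1)) * inverse (P\<^sup>2) = 2 * dP / P ^ 3"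
      using that by (simp add: divide_simps power2_eq_square power3_eq_cube)
    show ?thesis
      unfolding eq by (simp add: divide_inverse power2_eq_square algebra_simps)
  qed
  show ?thesis
    unfolding eh_G_def[abs_def]
    by (rule derivative_eq_intros refl assms pos power_not_zero)+ (rule ext, rule aux[OF pos])
qed

text \<open>Positivity: both summands are nonnegative, and if \<open>X $ 1\<close> vanishes then
  \<open>eh_eta q X\<close> is \<open>X $ 2\<close> times the positive number
  \<open>eh_P q / 2\<close>. This includes the points with \<open>q $ 2 = 0\<close>.\<close>

lemma metric_at_eh_G:
  assumes "t > 0"
  shows "metric_at (eh_G t) q"
proof (rule metric_at.intro)
  show "linear (eh_G t q X)" for q X
  proof (rule linearI)
    show "eh_G t q X (Y + Z) = eh_G t q X Y + eh_G t q X Z" for Y Z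
      by (simp add: eh_G_def eh_eta_add inner_add_right add_divide_distrib distrib_left)
    show "eh_G t q X (c *\<^sub>R Y) = c *\<^sub>R eh_G t q X Y" for c Y
      by (simp add: eh_G_def eh_eta_scale algebra_simps)
  qed
  show "eh_G t q X Y = eh_G t q Y X" for q X Y
    by (simp add: eh_G_def inner_commute)
  show "eh_G t q X X > 0" if "X \<noteq> 0" for X
  proof (cases "X $ 1 = 0")
    case True
    then have "X $ 2 \<noteq> 0"
      using that by (auto simp: vec_eq_iff forall_2)
    then have "eh_eta q X \<noteq> 0"
      using True eh_P_pos[of q] by (simp add: eh_eta_def)
    then have "(eh_eta q X \<bullet> eh_eta q X) / eh_L t q > 0"
      using eh_L_pos[OF assms, of q] by simp
    then show ?thesis
      by (simp add: eh_G_def True)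
  next
    case False
    then have "eh_L t q / (eh_P q)\<^sup>2 * (X $ 1 \<bullet> X $ 1) > 0"
      using eh_L_pos[OF assms, of q] eh_P_pos[of q] by simp
    moreover have "(eh_eta q X \<bullet> eh_eta q X) / eh_L t q \<ge> 0"
      using eh_L_pos[OF assms, of q] by simp
    ultimately show ?thesis
      unfolding eh_G_def by (rule mult_pos_pos[OF zero_less_numeral add_pos_nonneg])
  qed
  show "(\<lambda>q. eh_G t q X Y) differentiable (at q)" for X Y
    using eh_G_deriv[OF assms] by (rule differentiableI)
qed

section \<open>The potential as a function of u_1 and its complex Hessian off the zero
  section\<close>

definition eh_profile :: "real \<Rightarrow> real \<Rightarrow> real" where
  "eh_profile t u = sqrt (u\<^sup>2 + t^4) + t\<^sup>2 * ln (u / (sqrt (u\<^sup>2 + t^4) + t\<^sup>2))"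

text \<open>Equivalently, the derivative with respect to log u is sqrt (u^2 + t^4): the logarithmic
  term of the potential contributes exactly what the square root alone lacks.\<close>

lemma eh_profile_deriv:
  assumes "t > 0" and "u > 0"
  shows "(eh_profile t has_real_derivative sqrt (u\<^sup>2 + t^4) / u) (at u)"
proof -
  define R where "R = sqrt (u\<^sup>2 + t^4)"
  have pos: "u\<^sup>2 + t^4 > 0"
    using assms by (simp add: add_nonneg_pos)
  then have R: "R > 0" "R\<^sup>2 = u\<^sup>2 + t^4"
    by (simp_all add: R_def)
  have "R + t\<^sup>2 > 0"
    using R assms by (simp add: add_pos_pos)
  have dR: "((\<lambda>u. sqrt (u\<^sup>2 + t^4)) has_real_derivative u / R) (at u)"
    using pos by (auto intro!: derivative_eq_intros simp: R_def field_simps)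
  define a where "a = t\<^sup>2"
  have a: "a > 0" "R * R = u * u + a * a"
    using assms R(2) by (simp_all add: a_def power2_eq_square eval_nat_numeral)
  have num: "1 * (R + a) - u * (u / R) = a * (R + a) / R"
    using R(1) a(2) by (simp add: field_simps)
  have "a * b / R / (b * b) / (u / b) = a / (R * u)" if "b > 0" for b
    using that \<open>u > 0\<close> \<open>R > 0\<close> by (simp add: field_simps)
  from this[OF \<open>R + t\<^sup>2 > 0\<close>[folded a_def]]
  have quot: "(1 * (R + a) - u * (u / R)) / ((R + a) * (R + a)) / (u / (R + a)) = a / (R * u)"
    unfolding num .
  \<comment> \<open>The logarithm contributes a^2 / (R u), and R^2 = u^2 + a^2 merges the sum u / R
    + a^2 / (R u) into R / u.\<close>
  have eq: "u / R + a * ((1 * (R + a) - u * (u / R)) / ((R + a) * (R + a)) / (u / (R + a))) = R / u"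
  proof -
    have "u / R + a * (a / (R * u)) = (u * u + a * a) / (R * u)"
      using assms(2) R(1) by (simp add: field_simps)
    then show ?thesis
      unfolding quot a(2)[symmetric] using R(1) by simp
  qed
  have "((\<lambda>u. u / (sqrt (u\<^sup>2 + t^4) + t\<^sup>2)) has_real_derivative
      (1 * (R + t\<^sup>2) - u * (u / R)) / ((R + t\<^sup>2) * (R + t\<^sup>2))) (at u)"
    using \<open>R + t\<^sup>2 > 0\<close> DERIV_divide[OF DERIV_ident DERIV_add[OF dR DERIV_const[of "t\<^sup>2"]]]
    unfolding R_def by simp
  from DERIV_chain2[OF DERIV_ln_divide this]
  have "((\<lambda>u. ln (u / (sqrt (u\<^sup>2 + t^4) + t\<^sup>2))) has_real_derivative
      1 / (u / (R + t\<^sup>2)) * ((1 * (R + t\<^sup>2) - u * (u / R)) / ((R + t\<^sup>2) * (R + t\<^sup>2)))) (at u)"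
    using \<open>R + t\<^sup>2 > 0\<close> assms unfolding R_def by simp
  from DERIV_add[OF dR DERIV_cmult[OF this, of "t\<^sup>2"]]
  have "(eh_profile t has_real_derivative u / R + t\<^sup>2 * (1 / (u / (R + t\<^sup>2)) *
      ((1 * (R + t\<^sup>2) - u * (u / R)) / ((R + t\<^sup>2) * (R + t\<^sup>2))))) (at u)"
    unfolding eh_profile_def[abs_def] .
  moreover have "1 / x * y = y / x" for x y :: real
    by simp
  ultimately show ?thesis
    using eq unfolding R_def[symmetric] a_def by (simp only:)
qed

lemma eh_u1_chart: "eh_u1 (eh_chart q) = norm (q $ 2) * eh_P q"
proof -
  have "(cmod (csqrt z))\<^sup>2 = cmod z" for z
    by (metis norm_power power2_csqrt)
  then have "eh_u1 (eh_chart q) = (cmod (q $ 1))\<^sup>2 * cmod (q $ 2) + cmod (q $ 2)"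
    by transfer (simp add: norm_mult power_mult_distrib)
  then show ?thesis
    by (simp add: eh_P_def power2_norm_eq_inner[symmetric] algebra_simps)
qed

text \<open>The chain rule gives df = L d(log u_1); as u_1 = |w| P, the bracket is d(log |w|) +
  d(log P).\<close>

lemma eh_potential_deriv:
  assumes "t > 0" and "q $ 2 \<noteq> 0"
  shows "((\<lambda>q. eh_potential t (eh_chart q)) has_derivative
    (\<lambda>Z. eh_L t q * ((q $ 2 \<bullet> Z $ 2) / (q $ 2 \<bullet> q $ 2) + eh_dP q Z / eh_P q))) (at q)"
proof -
  let ?u = "\<lambda>q. norm (q $ 2) * eh_P q" and ?n = "norm (q $ 2)"
  have n: "?n > 0" "q $ 2 \<bullet> q $ 2 = ?n * ?n"
    using assms by (simp_all add: power2_norm_eq_inner[symmetric] power2_eq_square)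
  have P: "eh_P q > 0"
    by (rule eh_P_pos)
  have "((\<lambda>q::complex^2. norm (q $ 2)) has_derivative (\<lambda>Z. (q $ 2 \<bullet> Z $ 2) / ?n)) (at q)"
    using has_derivative_compose[OF bounded_linear_imp_has_derivative[OF bounded_linear_vec_nth]
        has_derivative_norm[of "q $ 2"]] assms
    by (simp add: sgn_div_norm inner_commute divide_inverse mult.commute)
  from has_derivative_mult[OF this eh_P_deriv]
  have u: "(?u has_derivative (\<lambda>Z. ?n * eh_dP q Z + (q $ 2 \<bullet> Z $ 2) / ?n * eh_P q)) (at q)" .
  have L: "sqrt ((?u q)\<^sup>2 + t^4) = eh_L t q"
    by (simp add: eh_L_def power_mult_distrib power2_norm_eq_inner)
  have "(eh_profile t has_real_derivative eh_L t q / ?u q) (at (?u q))"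
    using eh_profile_deriv[OF assms(1), of "?u q"] n P L by simp
  from DERIV_compose_FDERIV[OF this u]
  have "((\<lambda>q. eh_profile t (?u q)) has_derivative
    (\<lambda>Z. (?n * eh_dP q Z + (q $ 2 \<bullet> Z $ 2) / ?n * eh_P q) * (eh_L t q / ?u q))) (at q)" .
  moreover have "(\<lambda>q. eh_potential t (eh_chart q)) = (\<lambda>q. eh_profile t (?u q))"
    by (simp add: fun_eq_iff eh_potential_def eh_profile_def eh_u1_chart)
  moreover have "(?n * b + a / ?n * eh_P q) * (l / ?u q) =
      l * (a / (q $ 2 \<bullet> q $ 2) + b / eh_P q)" for a b l
    using n(1) P unfolding n(2) by (simp add: field_simps)
  ultimately show ?thesis
    by simp
qed

text \<open>L times the conjugate derivatives of log P and log |w|. The inverses are kept as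
  separate factors so that the product rule applies directly in the second differentiation.\<close>

lemma wirtinger_dzbar_eh_potential:
  assumes "t > 0" and "q $ 2 \<noteq> 0"
  shows "wirtinger_dzbar 1 (\<lambda>q. complex_of_real (eh_potential t (eh_chart q))) q =
      of_real (eh_L t q) * of_real (inverse (eh_P q)) * q $ 1"
    and "wirtinger_dzbar 2 (\<lambda>q. complex_of_real (eh_potential t (eh_chart q))) q =
      of_real (eh_L t q) * inverse (cnj (q $ 2)) / 2"
proof -
  note f = frechet_derivative_at[OF has_derivative_of_real[OF eh_potential_deriv[OF assms]],
      symmetric]
  have "complex_of_real (q $ 2 \<bullet> q $ 2) = cnj (q $ 2) * q $ 2"
    by (simp add: complex_eq_iff inner_complex_def)
  then have inv: "inverse (cnj (q $ 2)) = q $ 2 / of_real (q $ 2 \<bullet> q $ 2)"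
    using assms(2) by (simp add: field_simps)
  show "wirtinger_dzbar 1 (\<lambda>q. complex_of_real (eh_potential t (eh_chart q))) q =
      of_real (eh_L t q) * of_real (inverse (eh_P q)) * q $ 1"
    unfolding wirtinger_dzbar_def f
    by (simp add: eh_dP_def axis_def inner_complex_def complex_eq_iff field_simps)
  show "wirtinger_dzbar 2 (\<lambda>q. complex_of_real (eh_potential t (eh_chart q))) q =
      of_real (eh_L t q) * inverse (cnj (q $ 2)) / 2"
    unfolding wirtinger_dzbar_def f inv
    by (simp add: eh_dP_def axis_def inner_complex_def complex_eq_iff)
qed

lemma has_derivative_eh_dzbar:
  assumes "t > 0" and "q $ 2 \<noteq> 0"
  shows "((\<lambda>q. complex_of_real (eh_L t q) * of_real (inverse (eh_P q)) * q $ 1) has_derivative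
      (\<lambda>Z. of_real (eh_dL t q Z / eh_P q - eh_L t q * eh_dP q Z / (eh_P q)\<^sup>2) * q $ 1 +
        of_real (eh_L t q / eh_P q) * Z $ 1)) (at q)"
    and "((\<lambda>q. complex_of_real (eh_L t q) * inverse (cnj (q $ 2)) / 2) has_derivative
      (\<lambda>Z. of_real (eh_dL t q Z) / (2 * cnj (q $ 2)) -
        of_real (eh_L t q) * cnj (Z $ 2) / (2 * (cnj (q $ 2))\<^sup>2))) (at q)"
proof -
  have P: "eh_P q \<noteq> 0"
    using eh_P_pos[of q] by simp
  note L' = has_derivative_of_real[OF eh_L_deriv[OF assms(1)]]
  note P' = has_derivative_of_real[OF Deriv.has_derivative_inverse[OF P eh_P_deriv]]
  note z = has_derivative_vec_nth_complex[OF has_derivative_ident]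
  note w = Deriv.has_derivative_inverse[OF _ has_derivative_cnj[OF z], of q 2]
  show "((\<lambda>q. complex_of_real (eh_L t q) * of_real (inverse (eh_P q)) * q $ 1) has_derivative
      (\<lambda>Z. of_real (eh_dL t q Z / eh_P q - eh_L t q * eh_dP q Z / (eh_P q)\<^sup>2) * q $ 1 +
        of_real (eh_L t q / eh_P q) * Z $ 1)) (at q)"
    by (rule has_derivative_eq_rhs, rule has_derivative_mult[OF has_derivative_mult[OF L' P'] z])
       (simp add: fun_eq_iff divide_inverse power2_eq_square algebra_simps)
  show "((\<lambda>q. complex_of_real (eh_L t q) * inverse (cnj (q $ 2)) / 2) has_derivative
      (\<lambda>Z. of_real (eh_dL t q Z) / (2 * cnj (q $ 2)) -
        of_real (eh_L t q) * cnj (Z $ 2) / (2 * (cnj (q $ 2))\<^sup>2))) (at q)"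
    by (rule has_derivative_eq_rhs,
        rule bounded_linear.has_derivative[OF bounded_linear_divide has_derivative_mult[OF L' w]])
       (use assms in \<open>simp_all add: fun_eq_iff field_simps power2_eq_square\<close>)
qed


lemma open_off_zero_section: "open {q::complex^2. q $ 2 \<noteq> 0}"
  by (intro open_Collect_neq continuous_intros)

text \<open>The closed formulas hold on the open set off the zero section, so they may be
  differentiated there in place of the Wirtinger derivatives.\<close>

lemma has_derivative_wirtinger_dzbar_eh_potential:
  assumes "t > 0" and "q $ 2 \<noteq> 0"
  shows "(wirtinger_dzbar 1 (\<lambda>q. complex_of_real (eh_potential t (eh_chart q))) has_derivative
      (\<lambda>Z. of_real (eh_dL t q Z / eh_P q - eh_L t q * eh_dP q Z / (eh_P q)\<^sup>2) * q $ 1 +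
        of_real (eh_L t q / eh_P q) * Z $ 1)) (at q)"
    and "(wirtinger_dzbar 2 (\<lambda>q. complex_of_real (eh_potential t (eh_chart q))) has_derivative
      (\<lambda>Z. of_real (eh_dL t q Z) / (2 * cnj (q $ 2)) -
        of_real (eh_L t q) * cnj (Z $ 2) / (2 * (cnj (q $ 2))\<^sup>2))) (at q)"
  by (rule has_derivative_transform_within_open[OF has_derivative_eh_dzbar(1)[OF assms]
        open_off_zero_section],
      use assms in \<open>simp_all only: mem_Collect_eq wirtinger_dzbar_eh_potential not_False_eq_True\<close>)
     (rule has_derivative_transform_within_open[OF has_derivative_eh_dzbar(2)[OF assms]
        open_off_zero_section],
      use assms in \<open>simp_all only: mem_Collect_eq wirtinger_dzbar_eh_potential not_False_eq_True\<close>)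

lemma eh_potential_hessian:
  fixes t :: real and q :: "complex^2"
  assumes t: "t > 0" and q: "q $ 2 \<noteq> 0"
  defines "H \<equiv> \<lambda>a b. wirtinger_dz a
    (wirtinger_dzbar b (\<lambda>q. complex_of_real (eh_potential t (eh_chart q)))) q"
  shows "H 1 1 = of_real (eh_L t q / (eh_P q)\<^sup>2 + (q $ 2 \<bullet> q $ 2) * (q $ 1 \<bullet> q $ 1) / eh_L t q)"
    and "H 1 2 = of_real (eh_P q / (2 * eh_L t q)) * (q $ 2 * cnj (q $ 1))"
    and "H 2 1 = of_real (eh_P q / (2 * eh_L t q)) * (cnj (q $ 2) * q $ 1)"
    and "H 2 2 = of_real ((eh_P q)\<^sup>2 / (4 * eh_L t q))"
proof -
  let ?P = "eh_P q" and ?L = "eh_L t q" and ?z = "q $ 1" and ?w = "q $ 2"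
  have pos: "?P \<noteq> 0" "?L \<noteq> 0"
    using eh_P_pos[of q] eh_L_pos[OF t, of q] by auto
  note d = has_derivative_wirtinger_dzbar_eh_potential[OF t q, THEN frechet_derivative_at, symmetric]
  have dP: "eh_dP q (axis 1 1) = 2 * Re ?z" "eh_dP q (axis 1 \<i>) = 2 * Im ?z"
    "eh_dP q (axis 2 1) = 0" "eh_dP q (axis 2 \<i>) = 0"
    by (simp_all add: eh_dP_def axis_def inner_complex_def)
  define A where "A = (?w \<bullet> ?w) * ?P / ?L"
  have dL: "eh_dL t q (axis 1 1) = A * (2 * Re ?z)" "eh_dL t q (axis 1 \<i>) = A * (2 * Im ?z)"
    "eh_dL t q (axis 2 1) = ?P\<^sup>2 / (2 * ?L) * (2 * Re ?w)"
    "eh_dL t q (axis 2 \<i>) = ?P\<^sup>2 / (2 * ?L) * (2 * Im ?w)"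
    unfolding eh_dL_def dP A_def by (simp_all add: axis_def inner_complex_def)
  \<comment> \<open>A function with partial derivatives \<open>2 k Re x\<close> and
    \<open>2 k Im x\<close> has the holomorphic Wirtinger derivative \<open>k * cnj x\<close>;
    \<open>a\<close> and \<open>b\<close> carry the remaining terms of the two real
    derivatives.\<close>
  have comb: "(complex_of_real (k * (2 * Re x)) * y + a - \<i> * (of_real (k * (2 * Im x)) * y + b)) / 2 =
      of_real k * cnj x * y + (a - \<i> * b) / 2" for k x y a b
  proof -
    have eq: "cnj x = of_real (Re x) - \<i> * of_real (Im x)"
      by (simp add: complex_eq_iff)
    show ?thesis
      unfolding eq by (simp add: diff_divide_distrib add_divide_distrib algebra_simps)
  qed
  have sq: "complex_of_real (x \<bullet> x) = x * cnj x" for x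
    by (simp add: complex_eq_iff inner_complex_def)
  have ax: "(axis 1 x :: complex^2) $ 1 = x" "(axis 1 x :: complex^2) $ 2 = 0"
     "(axis 2 x :: complex^2) $ 1 = 0" "(axis 2 x :: complex^2) $ 2 = x" for x
    by (simp_all add: axis_def)
  have k11: "A * (2 * x) / ?P - ?L * (2 * x) / ?P\<^sup>2 = (A / ?P - ?L / ?P\<^sup>2) * (2 * x)" for x
    by (simp add: algebra_simps)
  have "H 1 1 = of_real (A / ?P - ?L / ?P\<^sup>2) * cnj ?z * ?z +
      (of_real (?L / ?P) - \<i> * (of_real (?L / ?P) * \<i>)) / 2"
    unfolding H_def wirtinger_dz_def d dP dL ax k11 comb mult_1_right ..
  also have "\<dots> = of_real ((A / ?P - ?L / ?P\<^sup>2) * (?z \<bullet> ?z) + ?L / ?P)"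
    unfolding of_real_add of_real_mult sq by (simp add: algebra_simps)
  also have "(A / ?P - ?L / ?P\<^sup>2) * (?z \<bullet> ?z) + ?L / ?P =
      ?L / ?P\<^sup>2 + (?w \<bullet> ?w) * (?z \<bullet> ?z) / ?L"
  proof -
    \<comment> \<open>Eliminating |\<zeta>|^2 reduces the terms in L to L / P^2 and leaves |w|^2
      |\<zeta>|^2 / L as the part belonging to \<eta>.\<close>
    have z: "?z \<bullet> ?z = ?P - 1"
      by (simp add: eh_P_def)
    show ?thesis
      unfolding z A_def using pos by (simp add: field_simps power2_eq_square)
  qed
  finally show "H 1 1 = of_real (?L / ?P\<^sup>2 + (?w \<bullet> ?w) * (?z \<bullet> ?z) / ?L)" .
  have "H 1 2 = (complex_of_real (A * (2 * Re ?z)) * (1 / (2 * cnj ?w)) + 0 -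
      \<i> * (of_real (A * (2 * Im ?z)) * (1 / (2 * cnj ?w)) + 0)) / 2"
    unfolding H_def wirtinger_dz_def d dP dL ax by simp
  also have "\<dots> = of_real (?P / (2 * ?L)) * (of_real (?w \<bullet> ?w) / cnj ?w * cnj ?z)"
    unfolding comb A_def by (simp add: mult_ac)
  also have "of_real (?w \<bullet> ?w) / cnj ?w = ?w"
    unfolding sq using q by simp
  finally show "H 1 2 = of_real (?P / (2 * ?L)) * (?w * cnj ?z)" .
  have k21: "?P\<^sup>2 / (2 * ?L) * (2 * x) / ?P - ?L * 0 / ?P\<^sup>2 = ?P / (2 * ?L) * (2 * x)" for x
    using pos by (simp add: power2_eq_square)
  show "H 2 1 = of_real (?P / (2 * ?L)) * (cnj ?w * ?z)"
    unfolding H_def wirtinger_dz_def d dP dL ax k21 comb by simp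
  \<comment> \<open>The factor \<open>1 / cnj ?w\<close> is antiholomorphic: its derivatives along 1
    and i cancel in \<open>wirtinger_dz\<close>, and only L is effectively differentiated.\<close>
  have "H 2 2 = (complex_of_real (?P\<^sup>2 / (2 * ?L) * (2 * Re ?w)) * (1 / (2 * cnj ?w)) +
        - (of_real ?L / (2 * (cnj ?w)\<^sup>2)) -
      \<i> * (of_real (?P\<^sup>2 / (2 * ?L) * (2 * Im ?w)) * (1 / (2 * cnj ?w)) +
        \<i> * (of_real ?L / (2 * (cnj ?w)\<^sup>2)))) / 2"
    unfolding H_def wirtinger_dz_def d dP dL ax by simp
  also have "\<dots> = of_real (?P\<^sup>2 / (4 * ?L))"
    unfolding comb using q by simp
  finally show "H 2 2 = of_real (?P\<^sup>2 / (4 * ?L))" .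
qed

lemma eh_metric_M4_eq:
  assumes "t > 0" and "q $ 2 \<noteq> 0"
  shows "eh_metric_M4 t q X Y = eh_G t q X Y"
proof -
  let ?P = "eh_P q" and ?L = "eh_L t q" and ?z = "q $ 1" and ?w = "q $ 2"
  \<comment> \<open>Replacing Y by JY turns the alternating expression into the symmetric one
    \<open>X * cnj Y + Y * cnj X\<close>.\<close>
  have mul: "\<i> * ((A * (a * cnj (\<i> * b) - (\<i> * b) * cnj a) + B * (a * cnj (\<i> * d) - (\<i> * b) * cnj c)) +
      (C * (c * cnj (\<i> * b) - (\<i> * d) * cnj a) + D * (c * cnj (\<i> * d) - (\<i> * d) * cnj c))) =
      (A * (a * cnj b + b * cnj a) + B * (a * cnj d + b * cnj c)) +
      (C * (c * cnj b + d * cnj a) + D * (c * cnj d + d * cnj c))" for A B C D a b c d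
    by (simp add: algebra_simps)
  \<comment> \<open>Completing the square: up to the term \<open>m\<close> in the \<zeta> direction
    the Hessian has rank one and is the square of \<eta>. Here \<open>m\<close> stands for L / P^2
    and \<open>k\<close> for 1 / L.\<close>
  have "Re (of_real (m + (w \<bullet> w) * (z \<bullet> z) * k) * (a * cnj b + b * cnj a) +
      of_real (P * k / 2) * (w * cnj z) * (a * cnj d + b * cnj c) +
      (of_real (P * k / 2) * (cnj w * z) * (c * cnj b + d * cnj a) +
       of_real (P\<^sup>2 * k / 4) * (c * cnj d + d * cnj c))) =
      2 * (m * (a \<bullet> b) + ((of_real (P / 2) * c + w * cnj z * a) \<bullet>
        (of_real (P / 2) * d + w * cnj z * b)) * k)"
    for m k P :: real and w z a b c d
    by (simp add: inner_complex_def power2_eq_square) (simp add: algebra_simps)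
  from this[of "?L / ?P\<^sup>2" ?w ?z "inverse ?L" "X $ 1" "Y $ 1" ?P "Y $ 2" "X $ 2"]
  show ?thesis
    unfolding eh_metric_M4_def i_ddbar_def eh_G_def eh_eta_def sum_2 vec_lambda_beta
      eh_potential_hessian[OF assms] mul
    by (simp add: field_simps)
qed

section \<open>Extension of the metric across the zero section\<close>

lemma islimpt_direction:
  fixes x v :: "'a::real_normed_vector"
  assumes "v \<noteq> 0" and "\<And>\<epsilon>. \<epsilon> > 0 \<Longrightarrow> x + \<epsilon> *\<^sub>R v \<in> S"
  shows "x islimpt S"
  unfolding islimpt_approachable
proof (intro allI impI)
  fix e :: real assume "e > 0"
  then show "\<exists>x'\<in>S. x' \<noteq> x \<and> dist x' x < e"
    using assms by (intro bexI[of _ "x + (e / (2 * norm v)) *\<^sub>R v"]) (auto simp: dist_norm)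
qed

text \<open>On the zero section the defining \<open>Lim\<close> is the value of the continuous
  \<open>eh_G\<close>. The limit is unique since each such point is a limit point of the
  complement.\<close>

lemma eh_metric_eq:
  assumes "t > 0"
  shows "eh_metric t = eh_G t"
proof (intro ext)
  fix q X Y
  let ?S = "{q::complex^2. q $ 2 \<noteq> 0}"
  show "eh_metric t q X Y = eh_G t q X Y"
  proof (cases "q $ 2 = 0")
    case True
    have "q islimpt ?S"
      by (rule islimpt_direction[of "axis 2 1"]) (simp_all add: True axis_def vec_eq_iff)
    moreover have "((\<lambda>q. eh_G t q X Y) \<longlongrightarrow> eh_G t q X Y) (at q within ?S)"
      using has_derivative_continuous[OF has_derivative_at_withinI[OF eh_G_deriv[OF assms]]]
      by (simp add: continuous_within)
    then have "((\<lambda>q. eh_metric_M4 t q X Y) \<longlongrightarrow> eh_G t q X Y) (at q within ?S)"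
      by (rule Lim_transform_within[OF _ zero_less_one]) (simp add: eh_metric_M4_eq[OF assms])
    ultimately show ?thesis
      by (simp add: eh_metric_def True tendsto_Lim trivial_limit_within)
  qed (simp add: eh_metric_def eh_metric_M4_eq[OF assms])
qed

section \<open>The unit normal\<close>

lemma has_real_derivative_Re:
  "(f has_vector_derivative d) (at s) \<Longrightarrow> ((\<lambda>s. Re (f s)) has_real_derivative Re d) (at s)"
  unfolding has_real_derivative_iff_has_vector_derivative
  by (rule bounded_linear.has_vector_derivative[OF bounded_linear_Re])

lemma has_real_derivative_Im:
  "(f has_vector_derivative d) (at s) \<Longrightarrow> ((\<lambda>s. Im (f s)) has_real_derivative Im d) (at s)"
  unfolding has_real_derivative_iff_has_vector_derivative
  by (rule bounded_linear.has_vector_derivative[OF bounded_linear_Im])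

lemma cover_coords_deriv:
  assumes "z $ 2 \<noteq> 0"
  shows "(cover_coords has_derivative
    (\<lambda>V. vector [V $ 1 / z $ 2 - z $ 1 * V $ 2 / (z $ 2)\<^sup>2, 2 * z $ 2 * V $ 2])) (at z)"
proof -
  have "((\<lambda>z::complex^2. z $ 1 / z $ 2) has_derivative
      (\<lambda>V. V $ 1 / z $ 2 - z $ 1 * V $ 2 / (z $ 2)\<^sup>2)) (at z)"
    by (rule derivative_eq_intros refl assms)+
       (use assms in \<open>simp add: fun_eq_iff field_simps power2_eq_square\<close>)
  moreover have "((\<lambda>z::complex^2. (z $ 2)\<^sup>2) has_derivative (\<lambda>V. 2 * z $ 2 * V $ 2)) (at z)"
    by (rule derivative_eq_intros refl)+ (simp add: fun_eq_iff)
  ultimately show ?thesis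
    unfolding cover_coords_def[abs_def] by (rule has_derivative_vector_2)
qed

text \<open>\<open>D n\<close> is the n-th derivative of \<Gamma> on \<open>I\<close>, fixed once so
  that second derivatives can be used without iterating \<open>deriv\<close>.\<close>

locale eh_curve =
  fixes t :: real and I :: "real set" and \<Gamma> :: "real \<Rightarrow> complex" and \<theta> :: "real \<Rightarrow> real"
    and D :: "nat \<Rightarrow> real \<Rightarrow> complex"
  assumes t: "t > 0" and open_I: "open I" and D_0: "D 0 = \<Gamma>"
    and D: "\<And>n s. s \<in> I \<Longrightarrow> (D n has_vector_derivative D (Suc n) s) (at s)"
    and unit_speed: "\<And>s. s \<in> I \<Longrightarrow> D 1 s \<bullet> D 1 s = 1"
    and polar: "\<And>s. s \<in> I \<Longrightarrow> \<Gamma> s = of_real (cmod (\<Gamma> s)) * cis (\<theta> s)"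
    and angle: "\<And>s. s \<in> I \<Longrightarrow> \<Gamma> s \<noteq> 0 \<Longrightarrow> \<theta> differentiable (at s)"
begin

lemma \<Gamma>_deriv: "s \<in> I \<Longrightarrow> (\<Gamma> has_vector_derivative D 1 s) (at s)"
  using D[of s 0] by (simp add: D_0)

lemma deriv_Re_D: "s \<in> I \<Longrightarrow> deriv (\<lambda>s. Re (D n s)) s = Re (D (Suc n) s)"
  by (rule DERIV_imp_deriv) (rule has_real_derivative_Re[OF D])

lemma deriv_Im_D: "s \<in> I \<Longrightarrow> deriv (\<lambda>s. Im (D n s)) s = Im (D (Suc n) s)"
  by (rule DERIV_imp_deriv) (rule has_real_derivative_Im[OF D])

lemmas deriv_Re = deriv_Re_D[of _ 0, unfolded D_0, folded One_nat_def]
  and deriv_Im = deriv_Im_D[of _ 0, unfolded D_0, folded One_nat_def]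

text \<open>Real and imaginary parts of cnj \<Gamma> \<Gamma>' = r r' + i r^2 \<theta>'. At a zero
  of \<Gamma> both sides vanish, whatever values \<open>deriv\<close> takes there.\<close>

lemma polar_derivs:
  assumes s: "s \<in> I"
  shows "cmod (\<Gamma> s) * deriv (\<lambda>s. cmod (\<Gamma> s)) s = Re (cnj (\<Gamma> s) * D 1 s)"
    and "cmod (\<Gamma> s) * (cmod (\<Gamma> s) * deriv \<theta> s) = Im (cnj (\<Gamma> s) * D 1 s)"
proof -
  let ?r = "\<lambda>s. cmod (\<Gamma> s)"
  have "?r s * deriv ?r s = Re (cnj (\<Gamma> s) * D 1 s) \<and>
      ?r s * (?r s * deriv \<theta> s) = Im (cnj (\<Gamma> s) * D 1 s)"
  proof (cases "\<Gamma> s = 0")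
    case False
    have "?r differentiable (at s)"
      using has_derivative_compose[OF \<Gamma>_deriv[OF s, unfolded has_vector_derivative_def]
          has_derivative_norm[OF False]] by (rule differentiableI)
    then have r: "(?r has_real_derivative deriv ?r s) (at s)"
      by (simp add: DERIV_deriv_iff_real_differentiable)
    have a: "(\<theta> has_real_derivative deriv \<theta> s) (at s)"
      using angle[OF s False] by (simp add: DERIV_deriv_iff_real_differentiable)
    have "((\<lambda>s. ?r s * cos (\<theta> s)) has_real_derivative
        deriv ?r s * cos (\<theta> s) - ?r s * (deriv \<theta> s * sin (\<theta> s))) (at s)"
      using r a by (auto intro!: derivative_eq_intros simp: algebra_simps)
    moreover have "?r s' * cos (\<theta> s') = Re (\<Gamma> s')" if "s' \<in> I" for s'
      using arg_cong[OF polar[OF that], of Re] by simp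
    ultimately have "((\<lambda>s. Re (\<Gamma> s)) has_real_derivative
        deriv ?r s * cos (\<theta> s) - ?r s * (deriv \<theta> s * sin (\<theta> s))) (at s)"
      by (rule has_field_derivative_transform_within_open[OF _ open_I s])
    then have re: "Re (D 1 s) = deriv ?r s * cos (\<theta> s) - ?r s * (deriv \<theta> s * sin (\<theta> s))"
      using DERIV_unique has_real_derivative_Re[OF \<Gamma>_deriv[OF s]] by blast
    have "((\<lambda>s. ?r s * sin (\<theta> s)) has_real_derivative
        deriv ?r s * sin (\<theta> s) + ?r s * (deriv \<theta> s * cos (\<theta> s))) (at s)"
      using r a by (auto intro!: derivative_eq_intros simp: algebra_simps)
    moreover have "?r s' * sin (\<theta> s') = Im (\<Gamma> s')" if "s' \<in> I" for s'
      using arg_cong[OF polar[OF that], of Im] by simp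
    ultimately have "((\<lambda>s. Im (\<Gamma> s)) has_real_derivative
        deriv ?r s * sin (\<theta> s) + ?r s * (deriv \<theta> s * cos (\<theta> s))) (at s)"
      by (rule has_field_derivative_transform_within_open[OF _ open_I s])
    then have im: "Im (D 1 s) = deriv ?r s * sin (\<theta> s) + ?r s * (deriv \<theta> s * cos (\<theta> s))"
      using DERIV_unique has_real_derivative_Im[OF \<Gamma>_deriv[OF s]] by blast
    have G: "Re (\<Gamma> s) = ?r s * cos (\<theta> s)" "Im (\<Gamma> s) = ?r s * sin (\<theta> s)"
      using arg_cong[OF polar[OF s], of Re] arg_cong[OF polar[OF s], of Im] by simp_all
    have sc: "sin (\<theta> s) * sin (\<theta> s) = 1 - cos (\<theta> s) * cos (\<theta> s)"
      using sin_cos_squared_add2[of "\<theta> s"] by (simp add: power2_eq_square algebra_simps)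
    have "R * r' = R * c * (r' * c - R * (a * s)) + R * s * (r' * s + R * (a * c)) \<and>
        R * (R * a) = R * c * (r' * s + R * (a * c)) - R * s * (r' * c - R * (a * s))"
      if "s * s = 1 - c * c" for R r' a s c :: real
      using that by algebra
    from this[OF sc, of "?r s" "deriv ?r s" "deriv \<theta> s"] show ?thesis
      by (simp add: re im G del: One_nat_def)
  qed simp
  then show "?r s * deriv ?r s = Re (cnj (\<Gamma> s) * D 1 s)"
    and "?r s * (?r s * deriv \<theta> s) = Im (cnj (\<Gamma> s) * D 1 s)"
    by auto
qed

lemma normal_polar_eq:
  assumes "s \<in> I"
  shows "normal_polar t \<Gamma> \<theta> s \<rho> \<phi> =
    (1 / 2 * sqrt (2 * \<rho>\<^sup>2 / sqrt (\<rho>^4 * ((cmod (\<Gamma> s))\<^sup>2 + 1)\<^sup>2 + t^4))) *\<^sub>R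
      vector [- \<i> * cis \<phi> * D 1 s, \<i> * cis \<phi> * (cnj (\<Gamma> s) * D 1 s)]"
proof -
  have pos: "(cmod (\<Gamma> s))\<^sup>2 + 1 \<noteq> 0"
    using zero_le_power2[of "cmod (\<Gamma> s)"] by linarith
  have c: "2 * \<rho>\<^sup>2 * ((cmod (\<Gamma> s))\<^sup>2 + 1) / X / ((cmod (\<Gamma> s))\<^sup>2 + 1) = 2 * \<rho>\<^sup>2 / X" for X
    using pos by simp
  \<comment> \<open>Regrouped so that r' and r \<theta>' occur only with the extra factor r, as
    \<open>polar_derivs\<close> requires.\<close>
  have lin: "- r * (x * sn + r * y * cs) = - (r * x * sn + r * (r * y) * cs)"
    "r * (x * cs - r * y * sn) = r * x * cs - r * (r * y) * sn" for r x y cs sn :: real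
    by (simp_all add: algebra_simps)
  show ?thesis
    unfolding normal_polar_def Let_def c lin polar_derivs[OF assms] deriv_Re[OF assms] deriv_Im[OF assms]
    by (simp add: vec_eq_iff forall_2 complex_eq_iff algebra_simps)
qed

section \<open>The normal as a smooth field in the chart\<close>

definition normal_dir :: "real^3 \<Rightarrow> complex^2" where
  "normal_dir x = vector [- \<i> * of_real (eh_P (M3_coords \<Gamma> x)) * D 1 (x $ 1),
     2 * \<i> * Complex (x $ 2) (x $ 3) * (cnj (\<Gamma> (x $ 1)) * D 1 (x $ 1))]"

definition normal_scale :: "real^3 \<Rightarrow> real" where
  "normal_scale x = sqrt (2 / eh_L t (M3_coords \<Gamma> x)) / 2"

text \<open>The push-forward is the same for all polar coordinates of the point, and at least one
  choice exists, so \<open>THE\<close> selects this value.\<close>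

lemma M3_normal_M4_eq:
  assumes s: "x $ 1 \<in> I" and w: "Complex (x $ 2) (x $ 3) \<noteq> 0"
  shows "M3_normal_M4 t \<Gamma> \<theta> x = normal_scale x *\<^sub>R normal_dir x"
proof -
  let ?s = "x $ 1" and ?w = "Complex (x $ 2) (x $ 3)"
  have cover: "eh_cover (M3_polar \<Gamma> ?s \<rho> \<phi>) = eh_chart (M3_coords \<Gamma> x) \<longleftrightarrow>
      (of_real \<rho> * cis \<phi>)\<^sup>2 = ?w" if "\<rho> > 0" for \<rho> \<phi>
  proof -
    have "eh_cover (M3_polar \<Gamma> ?s \<rho> \<phi>) = eh_chart (cover_coords (M3_polar \<Gamma> ?s \<rho> \<phi>))"
      using that by (subst eh_chart_cover_coords) (simp_all add: M3_polar_def)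
    then show ?thesis
      using that by (simp add: inj_eq[OF inj_eh_chart] cover_coords_def M3_coords_def M3_polar_def
          vec_eq_iff forall_2)
  qed
  have val: "frechet_derivative cover_coords (at (M3_polar \<Gamma> ?s \<rho> \<phi>))
      (normal_polar t \<Gamma> \<theta> ?s \<rho> \<phi>) = normal_scale x *\<^sub>R normal_dir x"
    if \<rho>: "\<rho> > 0" and w': "(of_real \<rho> * cis \<phi>)\<^sup>2 = ?w" for \<rho> \<phi>
  proof -
    have P: "eh_P (M3_coords \<Gamma> x) = (cmod (\<Gamma> ?s))\<^sup>2 + 1"
      by (simp add: eh_P_def M3_coords_def power2_norm_eq_inner)
    have "?w \<bullet> ?w = (cmod ((of_real \<rho> * cis \<phi>)\<^sup>2))\<^sup>2"
      unfolding w' by (rule power2_norm_eq_inner[symmetric])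
    then have ww: "?w \<bullet> ?w = \<rho>^4"
      by (simp add: norm_power norm_mult power_mult_distrib flip: power_mult)
    have L: "sqrt (\<rho>^4 * ((cmod (\<Gamma> ?s))\<^sup>2 + 1)\<^sup>2 + t^4) = eh_L t (M3_coords \<Gamma> x)"
      unfolding eh_L_def P by (simp add: M3_coords_def ww)
    have "sqrt (2 * \<rho>\<^sup>2 / l) = \<rho> * sqrt (2 / l)" for l
      using \<rho> by (simp add: real_sqrt_mult real_sqrt_divide)
    then have N: "normal_polar t \<Gamma> \<theta> ?s \<rho> \<phi> = (normal_scale x * \<rho>) *\<^sub>R
        vector [- \<i> * cis \<phi> * D 1 ?s, \<i> * cis \<phi> * (cnj (\<Gamma> ?s) * D 1 ?s)]"
      unfolding normal_polar_eq[OF s] L normal_scale_def by simp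
    have z: "M3_polar \<Gamma> ?s \<rho> \<phi> $ 2 \<noteq> 0"
      using \<rho> by (simp add: M3_polar_def)
    \<comment> \<open>In the first chart coordinate the two terms of the push-forward add up to a
      multiple of 1 + \<Gamma> cnj \<Gamma>, which is P.\<close>
    have P': "complex_of_real (eh_P (M3_coords \<Gamma> x)) = 1 + \<Gamma> ?s * cnj (\<Gamma> ?s)"
      unfolding P of_real_add complex_norm_square by simp
    show ?thesis
      unfolding frechet_derivative_at[OF cover_coords_deriv[OF z], symmetric] N normal_dir_def P'
        w'[symmetric]
      using \<rho> by (simp add: vec_eq_iff forall_2 M3_polar_def del: scaleR_scaleR)
        (simp add: scaleR_conv_of_real power2_eq_square field_simps)
  qed
  \<comment> \<open>Polar coordinates of a square root of w.\<close>
  define \<rho> where "\<rho> = sqrt (cmod ?w)"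
  define \<phi> where "\<phi> = Arg ?w / 2"
  have "\<rho> > 0"
    using w by (simp add: \<rho>_def)
  moreover have "(of_real \<rho> * cis \<phi>)\<^sup>2 = ?w"
  proof -
    have "(of_real \<rho> * cis \<phi>)\<^sup>2 = of_real (\<rho>\<^sup>2) * cis (Arg ?w)"
      by (simp add: power_mult_distrib Complex.DeMoivre \<phi>_def)
    also have "\<dots> = ?w"
      using w by (simp add: \<rho>_def cis_Arg sgn_eq)
    finally show ?thesis .
  qed
  ultimately have ex: "\<rho> > 0 \<and> (of_real \<rho> * cis \<phi>)\<^sup>2 = ?w"
    by blast
  show ?thesis
    unfolding M3_normal_M4_def
  proof (rule the_equality)
    show "\<forall>\<rho> \<phi>. \<rho> > 0 \<longrightarrow> eh_cover (M3_polar \<Gamma> ?s \<rho> \<phi>) = eh_chart (M3_coords \<Gamma> x) \<longrightarrow>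
        normal_scale x *\<^sub>R normal_dir x = frechet_derivative cover_coords
          (at (M3_polar \<Gamma> ?s \<rho> \<phi>)) (normal_polar t \<Gamma> \<theta> ?s \<rho> \<phi>)"
    proof (intro allI impI)
      fix \<rho> \<phi>
      assume "\<rho> > 0" "eh_cover (M3_polar \<Gamma> ?s \<rho> \<phi>) = eh_chart (M3_coords \<Gamma> x)"
      then show "normal_scale x *\<^sub>R normal_dir x = frechet_derivative cover_coords
          (at (M3_polar \<Gamma> ?s \<rho> \<phi>)) (normal_polar t \<Gamma> \<theta> ?s \<rho> \<phi>)"
        using val cover by metis
    qed
    fix V
    assume "\<forall>\<rho> \<phi>. \<rho> > 0 \<longrightarrow> eh_cover (M3_polar \<Gamma> ?s \<rho> \<phi>) = eh_chart (M3_coords \<Gamma> x) \<longrightarrow>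
        V = frechet_derivative cover_coords
          (at (M3_polar \<Gamma> ?s \<rho> \<phi>)) (normal_polar t \<Gamma> \<theta> ?s \<rho> \<phi>)"
    then show "V = normal_scale x *\<^sub>R normal_dir x"
      using ex cover val by metis
  qed
qed

definition coords_deriv :: "real^3 \<Rightarrow> real^3 \<Rightarrow> complex^2" where
  "coords_deriv x h = vector [h $ 1 *\<^sub>R D 1 (x $ 1), Complex (h $ 2) (h $ 3)]"

lemma has_derivative_D_nth:
  assumes "x $ 1 \<in> I"
  shows "((\<lambda>x::real^3. D n (x $ 1)) has_derivative (\<lambda>h. h $ 1 *\<^sub>R D (Suc n) (x $ 1))) (at x)"
  using has_derivative_compose[OF bounded_linear_imp_has_derivative[OF bounded_linear_vec_nth]
      D[OF assms, unfolded has_vector_derivative_def]] .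

lemma has_derivative_Complex_nth:
  "((\<lambda>x::real^3. Complex (x $ 2) (x $ 3)) has_derivative (\<lambda>h. Complex (h $ 2) (h $ 3))) (at x)"
  by (rule bounded_linear_imp_has_derivative, rule linear_conv_bounded_linear[THEN iffD1],
      rule linearI) (simp_all add: complex_eq_iff)

lemma M3_coords_deriv:
  assumes "x $ 1 \<in> I"
  shows "(M3_coords \<Gamma> has_derivative coords_deriv x) (at x)"
  unfolding M3_coords_def[abs_def] coords_deriv_def[abs_def]
  using has_derivative_D_nth[OF assms, of 0] has_derivative_Complex_nth
  by (intro has_derivative_vector_2) (simp_all add: D_0)

definition normal_dir_deriv :: "real^3 \<Rightarrow> real^3 \<Rightarrow> complex^2" where
  "normal_dir_deriv x h = vector [
     - \<i> * (of_real (eh_dP (M3_coords \<Gamma> x) (coords_deriv x h)) * D 1 (x $ 1) +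
       of_real (eh_P (M3_coords \<Gamma> x)) * (h $ 1 *\<^sub>R D 2 (x $ 1))),
     2 * \<i> * (Complex (h $ 2) (h $ 3) * (cnj (\<Gamma> (x $ 1)) * D 1 (x $ 1)) +
       Complex (x $ 2) (x $ 3) * (h $ 1 *\<^sub>R (cnj (D 1 (x $ 1)) * D 1 (x $ 1) +
         cnj (\<Gamma> (x $ 1)) * D 2 (x $ 1))))]"

lemma normal_dir_deriv:
  assumes "x $ 1 \<in> I"
  shows "(normal_dir has_derivative normal_dir_deriv x) (at x)"
proof -
  note P = has_derivative_of_real[OF has_derivative_compose[OF M3_coords_deriv[OF assms] eh_P_deriv]]
  note D0 = has_derivative_D_nth[OF assms, of 0, unfolded D_0]
  note D1 = has_derivative_D_nth[OF assms, of 1]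
  have S: "Suc (Suc 0) = 2"
    by simp
  show ?thesis
    unfolding normal_dir_def[abs_def]
    by (rule has_derivative_eq_rhs, rule has_derivative_vector_2[OF
          has_derivative_mult[OF has_derivative_mult_right[OF P] D1]
          has_derivative_mult[OF has_derivative_mult_right[OF has_derivative_Complex_nth]
            has_derivative_mult[OF has_derivative_cnj[OF D0] D1]]])
       (simp add: fun_eq_iff normal_dir_deriv_def S algebra_simps)
qed

lemma normal_scale_differentiable:
  assumes "x $ 1 \<in> I"
  shows "normal_scale differentiable (at x)"
proof -
  note L = has_derivative_compose[OF M3_coords_deriv[OF assms] eh_L_deriv[OF t]]
  have pos: "eh_L t (M3_coords \<Gamma> x) > 0"
    by (rule eh_L_pos[OF t])
  then have "2 / eh_L t (M3_coords \<Gamma> x) > 0"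
    by simp
  have "((\<lambda>y. sqrt (2 / y) / 2) has_real_derivative
      (- 2 / (y * y)) * (inverse (sqrt (2 / y)) / 2) / 2) (at y)" if "y > 0" for y :: real
    using that by (auto intro!: derivative_eq_intros)
  from DERIV_compose_FDERIV[OF this[OF pos] L] show ?thesis
    unfolding normal_scale_def[abs_def] by (rule differentiableI)
qed

text \<open>The derivative of the scale stays anonymous: its term is a multiple of
  \<open>normal_dir\<close>, which is orthogonal to the tangent space and disappears from the second
  fundamental form.\<close>

lemma normal_deriv:
  assumes "x $ 1 \<in> I"
  obtains \<xi>' where "((\<lambda>x. normal_scale x *\<^sub>R normal_dir x) has_derivative
    (\<lambda>h. normal_scale x *\<^sub>R normal_dir_deriv x h + \<xi>' h *\<^sub>R normal_dir x)) (at x)"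
  using normal_scale_differentiable[OF assms] has_derivative_scaleR[OF _ normal_dir_deriv[OF assms]]
  unfolding differentiable_def by blast

lemma open_params: "open {x::real^3. x $ 1 \<in> I}"
  using open_vimage_vec_nth[OF open_I, of 1] by (simp add: vimage_def)

lemma M3_normal_eq:
  assumes s: "x $ 1 \<in> I"
  shows "M3_normal t \<Gamma> \<theta> x = normal_scale x *\<^sub>R normal_dir x"
proof (cases "Complex (x $ 2) (x $ 3) = 0")
  case True
  let ?Z = "{x::real^3. Complex (x $ 2) (x $ 3) \<noteq> 0}"
  let ?N = "\<lambda>x. normal_scale x *\<^sub>R normal_dir x"
  have "x islimpt ?Z"
    by (rule islimpt_direction[of "axis 2 1"])
       (use True in \<open>auto simp: axis_def vec_eq_iff complex_eq_iff\<close>)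
  moreover have "(?N \<longlongrightarrow> ?N x) (at x within ?Z)"
  proof -
    obtain N' where "(?N has_derivative N') (at x)"
      using normal_deriv[OF s] by blast
    from has_derivative_continuous[OF has_derivative_at_withinI[OF this]] show ?thesis
      by (simp add: continuous_within)
  qed
  then have "(M3_normal_M4 t \<Gamma> \<theta> \<longlongrightarrow> ?N x) (at x within ?Z)"
  proof (rule Lim_transform_eventually)
    \<comment> \<open>The formula for the normal is available over \<open>I\<close>, so the limit is
      restricted to that open neighbourhood.\<close>
    have "eventually (\<lambda>y. y \<in> {x. x $ 1 \<in> I}) (at x within ?Z)"
      using s by (intro eventually_at_topological[THEN iffD2] exI[of _ "{x. x $ 1 \<in> I}"])
        (auto simp: open_params)
    moreover have "eventually (\<lambda>y. y \<in> ?Z) (at x within ?Z)"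
      by (simp add: eventually_at_filter)
    ultimately show "eventually (\<lambda>y. ?N y = M3_normal_M4 t \<Gamma> \<theta> y) (at x within ?Z)"
      by eventually_elim (simp add: M3_normal_M4_eq)
  qed
  ultimately show ?thesis
    by (simp add: M3_normal_def True tendsto_Lim trivial_limit_within)
next
  case False
  then show ?thesis
    by (simp add: M3_normal_def M3_normal_M4_eq[OF s])
qed

end

section \<open>The mean curvature\<close>

context eh_curve
begin

lemma k_g_eq:
  assumes s: "s \<in> I"
  shows "k_g \<Gamma> s = (Im (cnj (D 1 s) * D 2 s) * (1 + \<Gamma> s \<bullet> \<Gamma> s) - 2 * Im (cnj (\<Gamma> s) * D 1 s)) / 2"
proof -
  have eq: "deriv (deriv (\<lambda>s. Re (\<Gamma> s))) s = Re (D 2 s)" "deriv (deriv (\<lambda>s. Im (\<Gamma> s))) s = Im (D 2 s)"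
  proof -
    \<comment> \<open>The first derivative is known on a whole neighbourhood of \<open>s\<close>,
      which is what permits differentiating it again.\<close>
    have ev: "eventually (\<lambda>s. s \<in> I) (nhds s)"
      using open_I s by (rule eventually_nhds_in_open)
    have "deriv (deriv (\<lambda>s. Re (\<Gamma> s))) s = deriv (\<lambda>s. Re (D 1 s)) s"
      by (rule deriv_cong_ev[OF eventually_mono[OF ev] refl]) (rule deriv_Re)
    then show "deriv (deriv (\<lambda>s. Re (\<Gamma> s))) s = Re (D 2 s)"
      using deriv_Re_D[OF s, of 1] by (simp add: numeral_2_eq_2)
    have "deriv (deriv (\<lambda>s. Im (\<Gamma> s))) s = deriv (\<lambda>s. Im (D 1 s)) s"
      by (rule deriv_cong_ev[OF eventually_mono[OF ev] refl]) (rule deriv_Im)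
    then show "deriv (deriv (\<lambda>s. Im (\<Gamma> s))) s = Im (D 2 s)"
      using deriv_Im_D[OF s, of 1] by (simp add: numeral_2_eq_2)
  qed
  show ?thesis
    unfolding k_g_def Let_def eq deriv_Re[OF s] deriv_Im[OF s]
    by (simp add: power2_norm_eq_inner algebra_simps)
qed

context
  fixes x :: "real^3"
  assumes s: "x $ 1 \<in> I"
begin

abbreviation (input) "q \<equiv> M3_coords \<Gamma> x"
abbreviation (input) "T \<equiv> D 1 (x $ 1)"
abbreviation (input) "\<beta> \<equiv> - 2 * (q $ 2 * (cnj (\<Gamma> (x $ 1)) * T)) / of_real (eh_P q)"

text \<open>
  The image of the first vector spans the orthogonal complement of the fibre in the tangent space:
  \<open>\<beta>\<close> makes \<open>eh_eta\<close> vanish on it. This image equals \<open>\<i> normal_dir / P\<close>.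
\<close>

definition frame :: "3 \<Rightarrow> real^3" where
  "frame k = (if k = 1 then vector [1, Re \<beta>, Im \<beta>] else axis k 1)"

lemma q_nth: "q $ 1 = \<Gamma> (x $ 1)" "q $ 2 = Complex (x $ 2) (x $ 3)"
  by (simp_all add: M3_coords_def)

lemma coords_deriv_frame:
  "coords_deriv x (frame 1) = vector [T, \<beta>]"
  "coords_deriv x (frame 2) = vector [0, 1]"
  "coords_deriv x (frame 3) = vector [0, \<i>]"
  by (simp_all add: coords_deriv_def frame_def axis_def vec_eq_iff forall_2 complex_eq_iff)

lemma eta_frame:
  "eh_eta q (vector [T, \<beta>]) = 0"
  "eh_eta q (vector [0, 1]) = of_real (eh_P q / 2)"
  "eh_eta q (vector [0, \<i>]) = of_real (eh_P q / 2) * \<i>"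
  using eh_P_pos[of q] by (simp_all add: eh_eta_def q_nth)

lemma eta_normal: "eh_eta q (normal_dir x) = 0"
  by (simp add: eh_eta_def normal_dir_def q_nth)

lemma unit: "T \<bullet> T = 1"
  using unit_speed[OF s] .

text \<open>Each frame vector meets a single summand of the metric: \<eta> vanishes on the first,
  and the fibre vectors have no \<zeta> component.\<close>

lemma eh_G_frame:
  "eh_G t q (vector [T, \<beta>]) Y = 2 * (eh_L t q / (eh_P q)\<^sup>2 * (T \<bullet> Y $ 1))"
  "eh_G t q (vector [0, 1]) Y = eh_P q / eh_L t q * Re (eh_eta q Y)"
  "eh_G t q (vector [0, \<i>]) Y = eh_P q / eh_L t q * Im (eh_eta q Y)"
  unfolding eh_G_def eta_frame by (simp_all add: inner_complex_def)

lemma frame_orthogonal: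
  "eh_G t q (coords_deriv x (frame i)) (coords_deriv x (frame j)) = (if i = j then
    (if i = 1 then 2 * eh_L t q / (eh_P q)\<^sup>2 else (eh_P q)\<^sup>2 / (2 * eh_L t q)) else 0)"
  using exhaust_3[of i] exhaust_3[of j]
  by (elim disjE)
     (simp_all only: coords_deriv_frame eh_G_frame eta_frame, simp_all add: unit power2_eq_square del: One_nat_def)

lemma eh_G_frame_normal: "eh_G t q (coords_deriv x (frame k)) (normal_dir x) = 0"
proof -
  have "T \<bullet> normal_dir x $ 1 = 0"
    by (simp add: normal_dir_def inner_complex_def)
  then show ?thesis
    using exhaust_3[of k] by (elim disjE) (simp_all only: coords_deriv_frame eh_G_frame eta_normal, simp_all)
qed

abbreviation (input) "\<kappa>1 \<equiv> Im (cnj (\<Gamma> (x $ 1)) * T)"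
abbreviation (input) "\<kappa>2 \<equiv> Im (cnj T * D 2 (x $ 1))"

lemma dP_normal: "eh_dP q (c *\<^sub>R normal_dir x) = 2 * c * eh_P q * \<kappa>1"
  by (simp add: eh_dP_def normal_dir_def q_nth inner_complex_def algebra_simps)

text \<open>To first order the changes of |w|^2 and P^2 in the normal direction compensate: u_1 =
  |w| P is stationary, and L depends on u_1 alone.\<close>

lemma dL_normal: "eh_dL t q (c *\<^sub>R normal_dir x) = 0"
proof -
  have "q $ 2 \<bullet> (c *\<^sub>R normal_dir x) $ 2 = - 2 * c * \<kappa>1 * (q $ 2 \<bullet> q $ 2)"
    by (simp add: normal_dir_def q_nth inner_complex_def algebra_simps)
  then show ?thesis
    unfolding eh_dL_def dP_normal by (simp add: power2_eq_square)
qed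

text \<open>The frame vectors are held fixed while the base point moves. With L stationary, the
  first value comes from differentiating 1 / P^2, the other two from the factor P / 2 in
  \<eta>.\<close>

lemma dG_frame:
  "frechet_derivative (\<lambda>q. eh_G t q (vector [T, \<beta>]) (vector [T, \<beta>])) (at q) (c *\<^sub>R normal_dir x) =
    - 8 * c * eh_L t q * \<kappa>1 / (eh_P q)\<^sup>2"
  "frechet_derivative (\<lambda>q. eh_G t q (vector [0, 1]) (vector [0, 1])) (at q) (c *\<^sub>R normal_dir x) =
    2 * c * (eh_P q)\<^sup>2 * \<kappa>1 / eh_L t q"
  "frechet_derivative (\<lambda>q. eh_G t q (vector [0, \<i>]) (vector [0, \<i>])) (at q) (c *\<^sub>R normal_dir x) =
    2 * c * (eh_P q)\<^sup>2 * \<kappa>1 / eh_L t q"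
proof -
  have P: "eh_P q \<noteq> 0"
    using eh_P_pos[of q] by simp
  note d = frechet_derivative_at[OF eh_G_deriv[OF t], symmetric] dP_normal dL_normal
  show "frechet_derivative (\<lambda>q. eh_G t q (vector [T, \<beta>]) (vector [T, \<beta>])) (at q) (c *\<^sub>R normal_dir x) =
    - 8 * c * eh_L t q * \<kappa>1 / (eh_P q)\<^sup>2"
    unfolding d eta_frame using P unit by (simp add: power2_eq_square power3_eq_cube)
  show "frechet_derivative (\<lambda>q. eh_G t q (vector [0, 1]) (vector [0, 1])) (at q) (c *\<^sub>R normal_dir x) =
    2 * c * (eh_P q)\<^sup>2 * \<kappa>1 / eh_L t q"
    unfolding d eta_frame eh_deta_def by (simp add: inner_complex_def power2_eq_square)
  show "frechet_derivative (\<lambda>q. eh_G t q (vector [0, \<i>]) (vector [0, \<i>])) (at q) (c *\<^sub>R normal_dir x) =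
    2 * c * (eh_P q)\<^sup>2 * \<kappa>1 / eh_L t q"
    unfolding d eta_frame eh_deta_def by (simp add: inner_complex_def power2_eq_square)
qed

text \<open>The two fibre values are minus half the corresponding values of \<open>dG_frame\<close>
  for \<open>c = 1\<close>, so the fibre directions will cancel in the trace. In the first value the
  derivative of P drops out because T is orthogonal to i T.\<close>

lemma G_normal_deriv:
  "eh_G t q (vector [T, \<beta>]) (normal_dir_deriv x (frame 1)) = 2 * eh_L t q / eh_P q * \<kappa>2"
  "eh_G t q (vector [0, 1]) (normal_dir_deriv x (frame 2)) = - (eh_P q)\<^sup>2 * \<kappa>1 / eh_L t q"
  "eh_G t q (vector [0, \<i>]) (normal_dir_deriv x (frame 3)) = - (eh_P q)\<^sup>2 * \<kappa>1 / eh_L t q"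
proof -
  have P: "eh_P q \<noteq> 0"
    using eh_P_pos[of q] by simp
  have "T \<bullet> normal_dir_deriv x (frame 1) $ 1 = eh_P q * \<kappa>2"
    by (simp add: normal_dir_deriv_def frame_def inner_complex_def algebra_simps)
  then show "eh_G t q (vector [T, \<beta>]) (normal_dir_deriv x (frame 1)) = 2 * eh_L t q / eh_P q * \<kappa>2"
    unfolding eh_G_frame using P by (simp add: power2_eq_square)
  have dP: "eh_dP q (vector [0, y]) = 0" for y
    by (simp add: eh_dP_def)
  have f: "frame 2 = axis 2 1" "frame 3 = axis 3 1"
    by (simp_all add: frame_def)
  have "normal_dir_deriv x (frame 2) = vector [0, 2 * \<i> * (cnj (\<Gamma> (x $ 1)) * T)]"
    unfolding normal_dir_deriv_def coords_deriv_frame dP unfolding f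
    by (simp add: axis_def vec_eq_iff forall_2 complex_eq_iff)
  then show "eh_G t q (vector [0, 1]) (normal_dir_deriv x (frame 2)) = - (eh_P q)\<^sup>2 * \<kappa>1 / eh_L t q"
    unfolding eh_G_frame by (simp add: eh_eta_def power2_eq_square algebra_simps diff_divide_distrib)
  have "normal_dir_deriv x (frame 3) = vector [0, - 2 * (cnj (\<Gamma> (x $ 1)) * T)]"
    unfolding normal_dir_deriv_def coords_deriv_frame dP unfolding f
    by (simp add: axis_def vec_eq_iff forall_2 complex_eq_iff)
  then show "eh_G t q (vector [0, \<i>]) (normal_dir_deriv x (frame 3)) = - (eh_P q)\<^sup>2 * \<kappa>1 / eh_L t q"
    unfolding eh_G_frame by (simp add: eh_eta_def power2_eq_square algebra_simps diff_divide_distrib)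
qed

lemma mean_curvature_eq:
  "M3_mean_curvature t \<Gamma> \<theta> x = sqrt (2 / eh_L t q) * k_g \<Gamma> (x $ 1)"
proof -
  let ?\<xi> = "normal_scale x" and ?L = "eh_L t q" and ?P = "eh_P q"
  interpret metric_at "eh_G t" q
    by (rule metric_at_eh_G[OF t])
  have pos: "?P > 0" "?L > 0"
    using eh_P_pos[of q] eh_L_pos[OF t, of q] by auto
  obtain \<xi>' where "((\<lambda>x. normal_scale x *\<^sub>R normal_dir x) has_derivative
    (\<lambda>h. ?\<xi> *\<^sub>R normal_dir_deriv x h + \<xi>' h *\<^sub>R normal_dir x)) (at x)"
    using normal_deriv[OF s] by blast
  then have N: "(M3_normal t \<Gamma> \<theta> has_derivative
    (\<lambda>h. ?\<xi> *\<^sub>R normal_dir_deriv x h + \<xi>' h *\<^sub>R normal_dir x)) (at x)"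
    by (rule has_derivative_transform_within_open[OF _ open_params])
       (simp_all add: s M3_normal_eq)
  define c :: "3 \<Rightarrow> real" where "c i = (if i = 1 then 2 * ?L / ?P\<^sup>2 else ?P\<^sup>2 / (2 * ?L))" for i
  have c: "c i > 0" for i
    using pos by (simp add: c_def)
  have GN: "eh_G t q (coords_deriv x (frame k))
      (?\<xi> *\<^sub>R normal_dir_deriv x (frame k) + \<xi>' (frame k) *\<^sub>R normal_dir x) =
      ?\<xi> * eh_G t q (coords_deriv x (frame k)) (normal_dir_deriv x (frame k))" for k
    unfolding add_right scale_right eh_G_frame_normal by simp
  have "M3_mean_curvature t \<Gamma> \<theta> x = (\<Sum>k\<in>UNIV. (?\<xi> * eh_G t q (coords_deriv x (frame k))
      (normal_dir_deriv x (frame k)) + frechet_derivative (\<lambda>q. eh_G t q (coords_deriv x (frame k))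
        (coords_deriv x (frame k))) (at q) (?\<xi> *\<^sub>R normal_dir x) / 2) / c k)"
    unfolding M3_mean_curvature_def eh_metric_eq[OF t]
    using mean_curvature_orthogonal_frame[OF metric_at_eh_G[OF t] M3_coords_deriv[OF s] N
        frame_orthogonal[folded c_def] c]
    unfolding GN M3_normal_eq[OF s] .
  \<comment> \<open>Only the first frame vector is left; both fibre summands have become
    zero.\<close>
  also have "\<dots> = (?\<xi> * (2 * ?L / ?P * \<kappa>2) + - 8 * ?\<xi> * ?L * \<kappa>1 / ?P\<^sup>2 / 2) / (2 * ?L / ?P\<^sup>2)"
    unfolding sum_3 coords_deriv_frame G_normal_deriv dG_frame by (simp add: c_def)
  also have "\<dots> = ?\<xi> * (\<kappa>2 * ?P - 2 * \<kappa>1)"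
    using pos by (simp add: field_simps power2_eq_square)
  \<comment> \<open>The factor 1/2 in \<open>normal_scale\<close> becomes the factor 1/2 of
    \<open>k_g\<close>.\<close>
  also have "\<dots> = sqrt (2 / ?L) * k_g \<Gamma> (x $ 1)"
    unfolding k_g_eq[OF s] normal_scale_def by (simp add: eh_P_def q_nth)
  finally show ?thesis .
qed

end

end

section \<open>Curves in the round sphere\<close>

lemma round_metric_deriv:
  "((\<lambda>p. round_metric p X Y) has_derivative
    (\<lambda>Z. - 16 * (X \<bullet> Y) * (p \<bullet> Z) / (1 + p \<bullet> p)^3)) (at p)"
proof -
  have pos: "1 + p \<bullet> p > 0"
    by (simp add: add_pos_nonneg)
  have "((\<lambda>p. 1 + p \<bullet> p) has_derivative (\<lambda>Z. 2 * (p \<bullet> Z))) (at p)"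
    by (rule derivative_eq_intros refl)+ (simp add: fun_eq_iff inner_commute)
  moreover have "((\<lambda>y. 4 * (X \<bullet> Y) / y\<^sup>2) has_real_derivative - 8 * (X \<bullet> Y) / y^3) (at y)"
    if "y > 0" for y
    using that by (auto intro!: derivative_eq_intros simp: field_simps power2_eq_square power3_eq_cube)
  from DERIV_compose_FDERIV[OF this[OF pos] calculation]
  have "((\<lambda>p. 4 * (X \<bullet> Y) / (1 + p \<bullet> p)\<^sup>2) has_derivative
      (\<lambda>Z. 2 * (p \<bullet> Z) * (- 8 * (X \<bullet> Y) / (1 + p \<bullet> p)^3))) (at p)" .
  then show ?thesis
    unfolding round_metric_def[abs_def] inner_complex_def[of p p for p]
    by (simp add: power2_eq_square add.assoc mult_ac)
qed

lemma round_metric_eq: "round_metric p X Y = 4 * (X \<bullet> Y) / (1 + p \<bullet> p)\<^sup>2"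
  by (simp add: round_metric_def inner_complex_def[of p p] power2_eq_square add.assoc)

lemma metric_at_round_metric: "metric_at round_metric p"
proof (rule metric_at.intro)
  show "linear (round_metric p X)" for p X
    by (rule linearI)
       (simp_all add: round_metric_eq inner_add_right distrib_left add_divide_distrib)
  show "round_metric p X Y = round_metric p Y X" for p X Y
    by (simp add: round_metric_eq inner_commute)
  show "round_metric p X X > 0" if "X \<noteq> 0" for X
  proof -
    have "1 + p \<bullet> p > 0"
      by (simp add: add_pos_nonneg)
    then show ?thesis
      using that by (simp add: round_metric_eq)
  qed
  show "(\<lambda>p. round_metric p X Y) differentiable (at p)" for X Y
    using round_metric_deriv by (rule differentiableI)
qed

lemma norm_inv_stereo: "norm (inv_stereo p) = 1"
proof -
  have pos: "1 + (cmod p)\<^sup>2 > 0"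
    by (simp add: add_pos_nonneg)
  have "norm (vector [2 * Re p, 2 * Im p, (cmod p)\<^sup>2 - 1] :: real^3) = 1 + (cmod p)\<^sup>2"
  proof (rule power2_eq_imp_eq)
    show "(norm (vector [2 * Re p, 2 * Im p, (cmod p)\<^sup>2 - 1] :: real^3))\<^sup>2 = (1 + (cmod p)\<^sup>2)\<^sup>2"
      by (simp add: power2_norm_eq_inner inner_vec_def sum_3 inner_complex_def)
         (simp add: power2_eq_square algebra_simps)
  qed (use pos in auto)
  then show ?thesis
    using pos by (simp add: inv_stereo_def)
qed

lemma inner_inv_stereo_eq_0_iff:
  "a \<bullet> inv_stereo p = 0 \<longleftrightarrow> 2 * (a $ 1 * Re p + a $ 2 * Im p) + a $ 3 * (p \<bullet> p - 1) = 0"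
proof -
  have pos: "1 + (cmod p)\<^sup>2 > 0"
    by (simp add: add_pos_nonneg)
  have "a \<bullet> inv_stereo p =
      (2 * (a $ 1 * Re p + a $ 2 * Im p) + a $ 3 * (p \<bullet> p - 1)) / (1 + (cmod p)\<^sup>2)"
    by (simp add: inv_stereo_def inner_vec_def sum_3 power2_norm_eq_inner algebra_simps
        add_divide_distrib diff_divide_distrib)
  then show ?thesis
    using pos by simp
qed

text \<open>Inverse stereographic images lie on the unit sphere, so membership in a great circle
  reduces to the equation of its plane.\<close>

lemma great_circle_plane_iff:
  "(\<exists>C. great_circle C \<and> inv_stereo ` S \<subseteq> C) \<longleftrightarrow> (\<exists>a. a \<noteq> 0 \<and> (\<forall>p\<in>S. a \<bullet> inv_stereo p = 0))"
proof
  assume "\<exists>a. a \<noteq> 0 \<and> (\<forall>p\<in>S. a \<bullet> inv_stereo p = 0)"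
  then obtain a where "a \<noteq> 0" "\<forall>p\<in>S. a \<bullet> inv_stereo p = 0"
    by blast
  then have "great_circle {y \<in> sphere 0 1. a \<bullet> y = 0}"
    "inv_stereo ` S \<subseteq> {y \<in> sphere 0 1. a \<bullet> y = 0}"
    by (auto simp: great_circle_def norm_inv_stereo)
  then show "\<exists>C. great_circle C \<and> inv_stereo ` S \<subseteq> C"
    by blast
qed (auto simp: great_circle_def)

lemma quotient_has_vector_derivative_0:
  fixes f g :: "real \<Rightarrow> 'a::real_normed_field"
  assumes f: "(f has_vector_derivative f') (at s)" and g: "(g has_vector_derivative g') (at s)"
    and "g s \<noteq> 0" and "f' * g s = f s * g'"
  shows "((\<lambda>s. f s / g s) has_vector_derivative 0) (at s)"
proof -
  have "f' = f s * g' / g s"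
    using assms(3,4) by (simp add: field_simps)
  then have "- f s * (inverse (g s) * (h *\<^sub>R g') * inverse (g s)) + h *\<^sub>R f' / g s = 0" for h
    by (simp add: scaleR_conv_of_real divide_inverse mult_ac)
  then show ?thesis
    using has_derivative_divide[OF f[unfolded has_vector_derivative_def]
        g[unfolded has_vector_derivative_def] assms(3)]
    unfolding has_vector_derivative_def by simp
qed

section \<open>Geodesic curvature of the curve and the axis of its great circle\<close>

context eh_curve
begin

abbreviation (input) geo_\<kappa> :: "real \<Rightarrow> real" where
  "geo_\<kappa> s \<equiv> Im (cnj (D 1 s) * D 2 s)"

lemma D_2: "s \<in> I \<Longrightarrow> (D 1 has_vector_derivative D 2 s) (at s)"
  using D[of s 1] by (simp add: numeral_2_eq_2)

text \<open>Differentiating the unit-speed condition makes the second derivative orthogonal to the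
  tangent, hence a real multiple of i times it.\<close>

lemma D_2_eq:
  assumes s: "s \<in> I"
  shows "D 2 s = \<i> * of_real (geo_\<kappa> s) * D 1 s"
proof -
  have "((\<lambda>s. D 1 s \<bullet> D 1 s) has_derivative (\<lambda>h. D 1 s \<bullet> (h *\<^sub>R D 2 s) + (h *\<^sub>R D 2 s) \<bullet> D 1 s)) (at s)"
    using D_2[OF s] unfolding has_vector_derivative_def by (intro has_derivative_inner)
  then have "((\<lambda>s. 1) has_derivative (\<lambda>h. D 1 s \<bullet> (h *\<^sub>R D 2 s) + (h *\<^sub>R D 2 s) \<bullet> D 1 s)) (at s)"
    by (rule has_derivative_transform_within_open[OF _ open_I s]) (rule unit_speed)
  from has_derivative_unique[OF this has_derivative_const]
  have "(\<lambda>h. D 1 s \<bullet> (h *\<^sub>R D 2 s) + (h *\<^sub>R D 2 s) \<bullet> D 1 s) = (\<lambda>h. 0)" .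
  from fun_cong[OF this, of 1] have ortho: "Re (cnj (D 1 s) * D 2 s) = 0"
    by (simp add: inner_complex_def algebra_simps)
  have unit: "cnj (D 1 s) * D 1 s = 1"
    using unit_speed[OF s] by (simp add: complex_eq_iff inner_complex_def)
  have "D 2 s = (cnj (D 1 s) * D 2 s) * D 1 s"
    using unit by (metis mult.commute mult.left_commute mult_1_right)
  also have "cnj (D 1 s) * D 2 s = \<i> * of_real (geo_\<kappa> s)"
    using ortho by (simp add: complex_eq_iff)
  finally show ?thesis .
qed

lemma k_g_eq_geodesic_curvature:
  assumes s: "s \<in> I"
  shows "k_g \<Gamma> s = geodesic_curvature round_metric \<Gamma> s"
proof -
  interpret metric_at round_metric "\<Gamma> s"
    by (rule metric_at_round_metric)
  let ?T = "D 1 s" and ?P = "1 + \<Gamma> s \<bullet> \<Gamma> s" and ?\<kappa>1 = "Im (cnj (\<Gamma> s) * D 1 s)"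
  have pos: "?P > 0"
    by (simp add: add_pos_nonneg)
  have T: "vector_derivative \<Gamma> (at s) = D 1 s" if "s \<in> I" for s
    by (rule vector_derivative_at) (rule \<Gamma>_deriv[OF that])
  have "((\<lambda>s. vector_derivative \<Gamma> (at s)) has_derivative (\<lambda>h. h *\<^sub>R D 2 s)) (at s)"
    by (rule has_derivative_transform_within_open[OF D_2[OF s, unfolded has_vector_derivative_def]
          open_I s]) (simp add: T)
  note d = frechet_derivative_at[OF this, symmetric]
    frechet_derivative_at[OF \<Gamma>_deriv[OF s, unfolded has_vector_derivative_def], symmetric]
  have cov: "covariant_derivative round_metric \<Gamma> (\<lambda>s. vector_derivative \<Gamma> (at s)) s 1 =
      D 2 s + levi_civita round_metric (\<Gamma> s) ?T ?T"
    unfolding covariant_derivative_def d T[OF s] by simp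
  have unit: "?T \<bullet> ?T = 1" "(\<i> * ?T) \<bullet> (\<i> * ?T) = 1"
    using unit_speed[OF s] by (simp_all add: inner_complex_def)
  have "sqrt (4 / ?P\<^sup>2) = 2 / ?P"
    using pos by (simp add: real_sqrt_divide)
  then have \<nu>: "(\<i> * ?T) /\<^sub>R sqrt (round_metric (\<Gamma> s) (\<i> * ?T) (\<i> * ?T)) = (?P / 2) *\<^sub>R (\<i> * ?T)"
    unfolding round_metric_eq unit mult_1_right by simp
  note DG = frechet_derivative_at[OF round_metric_deriv, symmetric]
  have inner: "?T \<bullet> (\<i> * ?T) = 0" "\<Gamma> s \<bullet> (\<i> * ?T) = - ?\<kappa>1" "D 2 s \<bullet> (\<i> * ?T) = geo_\<kappa> s"
    by (simp_all add: inner_complex_def)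
  \<comment> \<open>Since T is orthogonal to i T, of the Koszul formula only the derivative of the
    conformal factor in the direction i T survives.\<close>
  have "round_metric (\<Gamma> s) (levi_civita round_metric (\<Gamma> s) ?T ?T) (\<i> * ?T) = - 8 * ?\<kappa>1 / ?P^3"
  proof -
    have "(- 16 * 0 * a / c + - 16 * 0 * a / c - - 16 * 1 * - b / c) / 2 = - 8 * b / c" for a b c :: real
      by simp
    then show ?thesis
      unfolding levi_civita_koszul DG inner unit .
  qed
  then have "round_metric (\<Gamma> s) (D 2 s + levi_civita round_metric (\<Gamma> s) ?T ?T)
      ((?P / 2) *\<^sub>R (\<i> * ?T)) = ?P / 2 * (4 * geo_\<kappa> s / ?P\<^sup>2 + - 8 * ?\<kappa>1 / ?P^3)"
    unfolding add_left scale_right by (simp only: round_metric_eq[of _ "D 2 s"] inner real_scaleR_def)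
  moreover have "round_metric (\<Gamma> s) ?T ?T = 4 / ?P\<^sup>2"
    unfolding round_metric_eq unit by simp
  ultimately have "geodesic_curvature round_metric \<Gamma> s =
      ?P / 2 * (4 * geo_\<kappa> s / ?P\<^sup>2 + - 8 * ?\<kappa>1 / ?P^3) / (4 / ?P\<^sup>2)"
    unfolding geodesic_curvature_def Let_def cov unfolding T[OF s] \<nu> by (simp only:)
  also have "\<dots> = (geo_\<kappa> s * ?P - 2 * ?\<kappa>1) / 2"
  proof -
    have "P / 2 * (4 * a / P\<^sup>2 + - 8 * b / P^3) / (4 / P\<^sup>2) = (a * P - 2 * b) / 2"
      if "P > 0" for P a b :: real
      using that by (simp add: field_simps power2_eq_square power3_eq_cube)
    from this[OF pos] show ?thesis .
  qed
  finally show ?thesis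
    unfolding k_g_eq[OF s] by simp
qed

lemma k_g_eq_0_of_plane:
  assumes s: "s \<in> I" and a: "a \<noteq> 0" and plane: "\<And>s. s \<in> I \<Longrightarrow> a \<bullet> inv_stereo (\<Gamma> s) = 0"
  shows "k_g \<Gamma> s = 0"
proof -
  define A where "A = Complex (a $ 1) (a $ 2)"
  \<comment> \<open>A function vanishing on the open set \<open>I\<close> has derivative zero there;
    applied to the plane equation and then to its derivative.\<close>
  have zero: "f' = 0" if "(f has_vector_derivative f') (at s)" "\<And>s. s \<in> I \<Longrightarrow> f s = 0" "s \<in> I"
    for f :: "real \<Rightarrow> real" and f' s
  proof -
    have "((\<lambda>_. 0) has_vector_derivative f') (at s)"
      using that by (auto intro: has_vector_derivative_transform_within_open[OF that(1) open_I])
    then show ?thesis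
      using vector_derivative_unique_at has_vector_derivative_const by blast
  qed
  have E0: "2 * (A \<bullet> \<Gamma> s) + a $ 3 * (\<Gamma> s \<bullet> \<Gamma> s - 1) = 0" if "s \<in> I" for s
    using plane[OF that] unfolding inner_inv_stereo_eq_0_iff A_def by (simp add: inner_complex_def)
  note \<Gamma>' = \<Gamma>_deriv[unfolded has_vector_derivative_def]
  note T' = D_2[unfolded has_vector_derivative_def]
  have E1: "A \<bullet> D 1 s + a $ 3 * (\<Gamma> s \<bullet> D 1 s) = 0" if s: "s \<in> I" for s
  proof -
    have "((\<lambda>s. 2 * (A \<bullet> \<Gamma> s) + a $ 3 * (\<Gamma> s \<bullet> \<Gamma> s - 1)) has_vector_derivative
        2 * (A \<bullet> D 1 s + a $ 3 * (\<Gamma> s \<bullet> D 1 s))) (at s)"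
      unfolding has_vector_derivative_def
      by (rule \<Gamma>'[OF s] derivative_eq_intros refl)+
         (simp add: fun_eq_iff inner_commute algebra_simps)
    from zero[OF this E0 s] show ?thesis
      by simp
  qed
  have E2: "A \<bullet> D 2 s + a $ 3 * (1 + \<Gamma> s \<bullet> D 2 s) = 0"
  proof -
    have "((\<lambda>s. A \<bullet> D 1 s + a $ 3 * (\<Gamma> s \<bullet> D 1 s)) has_vector_derivative
        A \<bullet> D 2 s + a $ 3 * (D 1 s \<bullet> D 1 s + \<Gamma> s \<bullet> D 2 s)) (at s)"
      unfolding has_vector_derivative_def
      by (rule \<Gamma>'[OF s] T'[OF s] derivative_eq_intros refl)+
         (simp add: fun_eq_iff inner_commute algebra_simps)
    from zero[OF this E1 s] show ?thesis
      unfolding unit_speed[OF s] .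
  qed
  \<comment> \<open>Cramer's rule for the plane equation and its first two derivatives, linear in
    the normal vector of the plane. The common factor is twice \<open>k_g\<close>, and
    \<open>(- k * y, k * x)\<close> is the second derivative of the curve.\<close>
  have alg: "a1 * (k * (1 + (u * u + v * v)) - 2 * (u * y - v * x)) = 0 \<and>
      a2 * (k * (1 + (u * u + v * v)) - 2 * (u * y - v * x)) = 0 \<and>
      a3 * (k * (1 + (u * u + v * v)) - 2 * (u * y - v * x)) = 0"
    if "2 * (a1 * u + a2 * v) + a3 * (u * u + v * v - 1) = 0"
      "a1 * x + a2 * y + a3 * (u * x + v * y) = 0"
      "a1 * (- k * y) + a2 * (k * x) + a3 * (1 + (u * (- k * y) + v * (k * x))) = 0"
      "x * x + y * y = 1" for a1 a2 a3 k u v x y :: real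
    using that by algebra
  define k where "k = geo_\<kappa> s"
  have D2: "D 2 s = \<i> * of_real k * D 1 s"
    unfolding k_def by (rule D_2_eq[OF s])
  have "a $ 1 * (k * (1 + \<Gamma> s \<bullet> \<Gamma> s) - 2 * Im (cnj (\<Gamma> s) * D 1 s)) = 0 \<and>
      a $ 2 * (k * (1 + \<Gamma> s \<bullet> \<Gamma> s) - 2 * Im (cnj (\<Gamma> s) * D 1 s)) = 0 \<and>
      a $ 3 * (k * (1 + \<Gamma> s \<bullet> \<Gamma> s) - 2 * Im (cnj (\<Gamma> s) * D 1 s)) = 0"
    using alg[of "a $ 1" "Re (\<Gamma> s)" "a $ 2" "Im (\<Gamma> s)" "a $ 3" "Re (D 1 s)" "Im (D 1 s)" k]
      E0[OF s] E1[OF s] E2 unit_speed[OF s]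
    unfolding A_def D2 inner_complex_def by simp
  then have "a $ i * (k * (1 + \<Gamma> s \<bullet> \<Gamma> s) - 2 * Im (cnj (\<Gamma> s) * D 1 s)) = 0" for i
    using exhaust_3[of i] by metis
  moreover obtain i where "a $ i \<noteq> 0"
    using a by (auto simp: vec_eq_iff)
  ultimately have "k * (1 + \<Gamma> s \<bullet> \<Gamma> s) - 2 * Im (cnj (\<Gamma> s) * D 1 s) = 0"
    by (metis mult_eq_0_iff)
  then show ?thesis
    unfolding k_g_eq[OF s] k_def by simp
qed

definition circle_axis_xy :: "real \<Rightarrow> complex" where
  "circle_axis_xy s = - \<i> * ((D 1 s + (\<Gamma> s)\<^sup>2 * cnj (D 1 s)) / of_real (1 + \<Gamma> s \<bullet> \<Gamma> s))"

definition circle_axis_z :: "real \<Rightarrow> real" where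
  "circle_axis_z s = 2 * (Im (cnj (\<Gamma> s) * D 1 s) / (1 + \<Gamma> s \<bullet> \<Gamma> s))"

text \<open>
  \<open>(circle_axis_xy, circle_axis_z)\<close> is the cross product of the curve in the sphere and its unit
  tangent vector.
\<close>

lemma circle_axis_deriv:
  assumes s: "s \<in> I" and k_g: "k_g \<Gamma> s = 0"
  shows "(circle_axis_xy has_vector_derivative 0) (at s)"
    and "(circle_axis_z has_vector_derivative 0) (at s)"
proof -
  let ?T = "D 1 s" and ?P = "1 + \<Gamma> s \<bullet> \<Gamma> s" and ?\<kappa>1 = "Im (cnj (\<Gamma> s) * D 1 s)"
  define k where "k = geo_\<kappa> s"
  have D2: "D 2 s = \<i> * of_real k * ?T"
    unfolding k_def by (rule D_2_eq[OF s])
  have "?P > 0"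
    by (simp add: add_pos_nonneg)
  then have pos: "?P \<noteq> 0" "complex_of_real ?P \<noteq> 0"
    unfolding of_real_eq_0_iff by simp_all
  \<comment> \<open>The vanishing of \<open>k_g\<close> enters here: it expresses the Euclidean
    curvature through position and tangent.\<close>
  have \<kappa>: "k * ?P = 2 * ?\<kappa>1"
    using k_g unfolding k_g_eq[OF s] k_def by simp
  note \<Gamma>' = \<Gamma>_deriv[OF s, unfolded has_vector_derivative_def]
  note T' = D_2[OF s, unfolded has_vector_derivative_def]
  have unit: "?T * cnj ?T = 1"
    using unit_speed[OF s] by (simp add: complex_eq_iff inner_complex_def)
  have P': "((\<lambda>s. 1 + \<Gamma> s \<bullet> \<Gamma> s) has_vector_derivative 2 * (\<Gamma> s \<bullet> ?T)) (at s)"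
    unfolding has_vector_derivative_def
    by (rule \<Gamma>' derivative_eq_intros refl)+ (simp add: fun_eq_iff inner_commute)
  have "((\<lambda>s. D 1 s + (\<Gamma> s)\<^sup>2 * cnj (D 1 s)) has_vector_derivative
      D 2 s + 2 * \<Gamma> s * (?T * cnj ?T) + (\<Gamma> s)\<^sup>2 * cnj (D 2 s)) (at s)"
    unfolding has_vector_derivative_def
    by (rule \<Gamma>' T' derivative_eq_intros refl)+
       (simp add: fun_eq_iff scaleR_conv_of_real algebra_simps)
  \<comment> \<open>The numerator of the quotient rule vanishes: a polynomial identity in \<Gamma>,
    T and their conjugates, modulo the unit-speed relation.\<close>
  moreover have "(D 2 s + 2 * \<Gamma> s * (?T * cnj ?T) + (\<Gamma> s)\<^sup>2 * cnj (D 2 s)) * of_real ?P =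
      (?T + (\<Gamma> s)\<^sup>2 * cnj ?T) * of_real (2 * (\<Gamma> s \<bullet> ?T))"
  proof -
    have "\<i> * of_real k * of_real ?P = cnj (\<Gamma> s) * ?T - \<Gamma> s * cnj ?T"
      using arg_cong[OF \<kappa>, of complex_of_real] by (simp add: complex_eq_iff)
    moreover have "of_real ?P = 1 + \<Gamma> s * cnj (\<Gamma> s)"
      "of_real (2 * (\<Gamma> s \<bullet> ?T)) = cnj (\<Gamma> s) * ?T + \<Gamma> s * cnj ?T"
      by (simp_all add: complex_eq_iff inner_complex_def)
    moreover have "D 2 s = \<i> * of_real k * ?T" "cnj (D 2 s) = - (\<i> * of_real k) * cnj ?T"
      unfolding D2 by simp_all
    ultimately show ?thesis
      using unit by algebra
  qed
  ultimately have "((\<lambda>s. (D 1 s + (\<Gamma> s)\<^sup>2 * cnj (D 1 s)) / of_real (1 + \<Gamma> s \<bullet> \<Gamma> s))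
      has_vector_derivative 0) (at s)"
    using quotient_has_vector_derivative_0[OF _ bounded_linear.has_vector_derivative[OF bounded_linear_of_real P'] pos(2)] by blast
  from has_vector_derivative_mult_right[OF this, of "- \<i>"]
  show "(circle_axis_xy has_vector_derivative 0) (at s)"
    unfolding circle_axis_xy_def[abs_def] by simp
  have "((\<lambda>s. Im (cnj (\<Gamma> s) * D 1 s)) has_vector_derivative
      Im (cnj ?T * ?T + cnj (\<Gamma> s) * D 2 s)) (at s)"
    unfolding has_vector_derivative_def
    by (rule \<Gamma>' T' derivative_eq_intros refl)+ (simp add: fun_eq_iff algebra_simps)
  moreover have "Im (cnj ?T * ?T + cnj (\<Gamma> s) * D 2 s) * ?P = ?\<kappa>1 * (2 * (\<Gamma> s \<bullet> ?T))"
  proof -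
    have "Im (cnj ?T * ?T + cnj (\<Gamma> s) * D 2 s) = k * (\<Gamma> s \<bullet> ?T)"
      unfolding D2 by (simp add: inner_complex_def algebra_simps)
    then show ?thesis
      using \<kappa> by algebra
  qed
  ultimately have "((\<lambda>s. Im (cnj (\<Gamma> s) * D 1 s) / (1 + \<Gamma> s \<bullet> \<Gamma> s)) has_vector_derivative 0) (at s)"
    using quotient_has_vector_derivative_0[OF _ P' pos(1)] by blast
  from has_vector_derivative_mult_right[OF this, of 2]
  show "(circle_axis_z has_vector_derivative 0) (at s)"
    unfolding circle_axis_z_def[abs_def] by simp
qed

text \<open>A cross product is orthogonal to its first factor, here the point on the sphere.\<close>

lemma circle_axis_plane:
  "2 * (circle_axis_xy s \<bullet> \<Gamma> s) + circle_axis_z s * (\<Gamma> s \<bullet> \<Gamma> s - 1) = 0"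
proof -
  let ?P = "1 + \<Gamma> s \<bullet> \<Gamma> s" and ?\<kappa>1 = "Im (cnj (\<Gamma> s) * D 1 s)"
  have "circle_axis_xy s = (1 / ?P) *\<^sub>R (- \<i> * (D 1 s + (\<Gamma> s)\<^sup>2 * cnj (D 1 s)))"
    unfolding circle_axis_xy_def scaleR_conv_of_real by simp
  then have "circle_axis_xy s \<bullet> \<Gamma> s = 1 / ?P * ((- \<i> * (D 1 s + (\<Gamma> s)\<^sup>2 * cnj (D 1 s))) \<bullet> \<Gamma> s)"
    by simp
  also have "(- \<i> * (D 1 s + (\<Gamma> s)\<^sup>2 * cnj (D 1 s))) \<bullet> \<Gamma> s = ?\<kappa>1 * (1 - \<Gamma> s \<bullet> \<Gamma> s)"
    by (simp add: inner_complex_def power2_eq_square algebra_simps)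
  finally show ?thesis
    unfolding circle_axis_z_def by (simp only: times_divide_eq_right times_divide_eq_left mult_1_left)
      (simp add: algebra_simps diff_divide_distrib)
qed

text \<open>If both parts vanished, \<Gamma> cnj T would be a real number m, and multiplying the
  first part's numerator by cnj T would give 1 + m^2 = 0.\<close>

lemma circle_axis_nonzero:
  assumes "s \<in> I"
  shows "circle_axis_xy s \<noteq> 0 \<or> circle_axis_z s \<noteq> 0"
proof (rule ccontr)
  assume "\<not> ?thesis"
  moreover have "1 + \<Gamma> s \<bullet> \<Gamma> s > 0"
    by (simp add: add_pos_nonneg)
  then have pos: "1 + \<Gamma> s \<bullet> \<Gamma> s \<noteq> 0" "complex_of_real (1 + \<Gamma> s \<bullet> \<Gamma> s) \<noteq> 0"
    unfolding of_real_eq_0_iff by simp_all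
  ultimately have xy: "D 1 s + (\<Gamma> s)\<^sup>2 * cnj (D 1 s) = 0" and z: "Im (cnj (\<Gamma> s) * D 1 s) = 0"
    unfolding circle_axis_xy_def circle_axis_z_def by auto
  let ?m = "Re (cnj (\<Gamma> s) * D 1 s)"
  have m: "\<Gamma> s * cnj (D 1 s) = of_real ?m"
    using z by (simp add: complex_eq_iff)
  have unit: "D 1 s * cnj (D 1 s) = 1"
    using unit_speed[OF assms] by (simp add: complex_eq_iff inner_complex_def)
  have "1 + (of_real ?m)\<^sup>2 = (D 1 s + (\<Gamma> s)\<^sup>2 * cnj (D 1 s)) * cnj (D 1 s)"
    unfolding m[symmetric] using unit by algebra
  also have "\<dots> = 0"
    unfolding xy by simp
  finally have "complex_of_real (1 + ?m\<^sup>2) = 0"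
    by (simp only: of_real_add of_real_1 of_real_power)
  then have "1 + ?m\<^sup>2 = 0"
    unfolding of_real_eq_0_iff .
  then show False
    using zero_le_power2[of ?m] by linarith
qed

text \<open>The axis has zero derivative on an interval, so one constant vector serves as normal of
  the plane for all parameters.\<close>

lemma plane_of_k_g_eq_0:
  assumes I: "is_interval I" and k: "\<And>s. s \<in> I \<Longrightarrow> k_g \<Gamma> s = 0"
  shows "\<exists>a. a \<noteq> 0 \<and> (\<forall>s\<in>I. a \<bullet> inv_stereo (\<Gamma> s) = 0)"
proof (cases "I = {}")
  case True
  then show ?thesis
    by (intro exI[of _ "axis 1 1"]) simp
next
  case False
  then obtain s0 where s0: "s0 \<in> I"
    by blast
  have "convex I"
    using I by (simp add: is_interval_convex_1)
  then obtain A b where A: "\<And>s. s \<in> I \<Longrightarrow> circle_axis_xy s = A"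
    and b: "\<And>s. s \<in> I \<Longrightarrow> circle_axis_z s = b"
    using has_vector_derivative_zero_constant[of I circle_axis_xy]
      has_vector_derivative_zero_constant[of I circle_axis_z]
      circle_axis_deriv k has_vector_derivative_at_within by metis
  let ?a = "vector [Re A, Im A, b] :: real^3"
  have "?a \<noteq> 0"
    using circle_axis_nonzero[OF s0] A[OF s0] b[OF s0]
    by (auto simp: vec_eq_iff forall_3 complex_eq_iff)
  moreover have "?a \<bullet> inv_stereo (\<Gamma> s) = 0" if "s \<in> I" for s
    using circle_axis_plane[of s] A[OF that] b[OF that]
    by (simp add: inner_inv_stereo_eq_0_iff inner_complex_def)
  ultimately show ?thesis
    by blast
qed

end

theorem corollary1:
  fixes t :: real and I :: "real set" and \<Gamma> :: "real \<Rightarrow> complex" and \<theta> :: "real \<Rightarrow> real"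
  assumes "t > 0"
    and "open I" and "is_interval I"
    and "smooth_curve_on I \<Gamma>"
    and "\<forall>s\<in>I. (deriv (\<lambda>s. Re (\<Gamma> s)) s)\<^sup>2 + (deriv (\<lambda>s. Im (\<Gamma> s)) s)\<^sup>2 = 1"
    and "\<forall>s\<in>I. \<Gamma> s = of_real (cmod (\<Gamma> s)) * cis (\<theta> s)"
    and "\<forall>s\<in>I. \<Gamma> s \<noteq> 0 \<longrightarrow> \<theta> differentiable (at s)"
  shows
    "(\<forall>s\<in>I. \<forall>\<rho>>0. \<forall>\<phi>. M3_mean_curvature t \<Gamma> \<theta> (polar_params s \<rho> \<phi>) =
        sqrt (2 / sqrt (\<rho>^4 * ((cmod (\<Gamma> s))\<^sup>2 + 1)\<^sup>2 + t^4)) * k_g \<Gamma> s) \<and>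
     (\<forall>s\<in>I. k_g \<Gamma> s = geodesic_curvature round_metric \<Gamma> s) \<and>
     (M3_minimal t I \<Gamma> \<theta> \<longleftrightarrow> (\<forall>s\<in>I. k_g \<Gamma> s = 0)) \<and>
     ((\<forall>s\<in>I. k_g \<Gamma> s = 0) \<longleftrightarrow> (\<exists>C. great_circle C \<and> inv_stereo ` \<Gamma> ` I \<subseteq> C))"
proof -
  obtain D where D: "D 0 = \<Gamma>" "\<And>n s. s \<in> I \<Longrightarrow> (D n has_vector_derivative D (Suc n) s) (at s)"
    using assms(4) by (auto simp: smooth_curve_on_def)
  interpret eh_curve t I \<Gamma> \<theta> D
  proof
    show "D 1 s \<bullet> D 1 s = 1" if s: "s \<in> I" for s
    proof -
      have \<Gamma>': "(\<Gamma> has_vector_derivative D 1 s) (at s)"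
        using D(2)[OF s, of 0] by (simp add: D(1))
      show ?thesis
        using bspec[OF assms(5) s]
        unfolding DERIV_imp_deriv[OF has_real_derivative_Re[OF \<Gamma>']]
          DERIV_imp_deriv[OF has_real_derivative_Im[OF \<Gamma>']]
        by (simp add: inner_complex_def power2_eq_square)
    qed
  qed (use assms D in auto)
  have "M3_mean_curvature t \<Gamma> \<theta> (polar_params s \<rho> \<phi>) =
      sqrt (2 / sqrt (\<rho>^4 * ((cmod (\<Gamma> s))\<^sup>2 + 1)\<^sup>2 + t^4)) * k_g \<Gamma> s" if "s \<in> I" for s \<rho> \<phi>
  proof -
    let ?x = "polar_params s \<rho> \<phi>"
    have x: "?x $ 1 = s"
      by (simp add: polar_params_def)
    \<comment> \<open>The fibre coordinate is the square of \<rho> e^(i \<phi>), which explains the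
      doubled angle and |w|^2 = \<rho>^4.\<close>
    have "Complex (?x $ 2) (?x $ 3) = of_real (\<rho>\<^sup>2) * cis (2 * \<phi>)"
      by (simp add: polar_params_def complex_eq_iff)
    then have "Complex (?x $ 2) (?x $ 3) \<bullet> Complex (?x $ 2) (?x $ 3) = \<rho>^4"
      by (simp add: power2_norm_eq_inner[symmetric] norm_mult norm_power flip: power_mult)
    then have "eh_L t (M3_coords \<Gamma> ?x) = sqrt (\<rho>^4 * ((cmod (\<Gamma> s))\<^sup>2 + 1)\<^sup>2 + t^4)"
      by (simp add: eh_L_def eh_P_def M3_coords_def x power2_norm_eq_inner add.commute)
    then show ?thesis
      using mean_curvature_eq[of ?x] that by (simp add: x)
  qed
  moreover have "M3_minimal t I \<Gamma> \<theta> \<longleftrightarrow> (\<forall>s\<in>I. k_g \<Gamma> s = 0)"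
  proof -
    \<comment> \<open>The factor in front of \<open>k_g\<close> is positive at every point, the zero
      section included.\<close>
    have "M3_mean_curvature t \<Gamma> \<theta> x = 0 \<longleftrightarrow> k_g \<Gamma> (x $ 1) = 0" if "x $ 1 \<in> I" for x
      using mean_curvature_eq[OF that] eh_L_pos[OF t, of "M3_coords \<Gamma> x"] by simp
    then show ?thesis
      unfolding M3_minimal_def by (metis vector_3(1))
  qed
  moreover have "(\<forall>s\<in>I. k_g \<Gamma> s = 0) \<longleftrightarrow> (\<exists>C. great_circle C \<and> inv_stereo ` \<Gamma> ` I \<subseteq> C)"
    unfolding great_circle_plane_iff
    using plane_of_k_g_eq_0[OF assms(3)] k_g_eq_0_of_plane by auto
  ultimately show ?thesis
    using k_g_eq_geodesic_curvature by simp
qed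

end
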